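(* Let $n\ge1$ and $0\le m\le 2n$ be integers, and let $H'_{n,m}$, $\langle-,-\rangle$ and $L$ be as defined in the context. Then: (a) (Poincaré duality) The bilinear pairing $\langle-,-\rangle:H'_{n,m}\times H'_{n,m}\to\mathbb{R}$ is an $S_n$-equivariant symmetric graded bilinear form, which is non-degenerate. (b) (Hard Lefschetz) $L:(H'_{n,m})^{i}\to (H'_{n,m})^{i+2}$ is an $S_n$-equivariant Lefschetz operator satisfying the hard Lefschetz theorem, i.e., for all $i\ge0$, $L^i:(H'_{n,m})^{-i}\to (H'_{n,m})^{i}$ is an isomorphism. (c) (Hodge--Riemann relations) For all integers $0\le i\le m/2$, the bilinear form $(a,b)_L^{-m+2i}=\langle a,L^{m-2i}b\rangle$ on $(H'_{n,m})^{-m+2i}$ is $S_n$-equivariant and is $(-1)^{i-s}$-definite on the primitive subspace $(P'_L)^{-m+2i}=\ker(L^{m-2i+1})\cap (H'_{n,m})^{-m+2i}$, where $s=\max(0,m-n)$.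
   Context: Let $V$ be a real vector space with basis $\theta_1,\dots,\theta_n$ and $V^*$ its dual with dual basis $\xi_1,\dots,\xi_n$. Let $\Lambda^i=\Lambda^i(V)$ and $(\Lambda^* )^j=\Lambda^j(V^* )$ be the exterior powers (zero unless the exponent is between $0$ and $n$). Put $H'_{n,m}=\bigoplus_{i=0}^m (H'_{n,m})^{-m+2i}$ with $(H'_{n,m})^{-m+2i}:=\Lambda^i\otimes(\Lambda^* )^{m-i}$ (all other graded pieces are $0$). $S_n$ acts by permuting the indices of the $\theta_k$ and of the $\xi_k$, hence on exterior powers and on $H'_{n,m}$. Let $(-,-):\Lambda^i\times(\Lambda^* )^j\to\mathbb{R}$ be the bilinear pairing with $(u_1\wedge\dots\wedge u_i,\,v_1^*\wedge\dots\wedge v_j^* )=\det(v_k^*(u_l))$ if $i=j$, and $0$ if $i\ne j$. The pairing on $H'_{n,m}$ is the bilinear extension of $\langle u\otimes v^*,u'\otimes (v^* )'\rangle:=(-1)^{\varepsilon}(u,(v^* )')(u',v^* )$, where $\varepsilon=m(m-1)/2$ if $0\le m\le n$ and $\varepsilon=(2n-m)(2n-m-1)/2$ if $n<m\le 2n$. The operator is $L:=\sum_{k=1}^n e_{\theta_k}\otimes i_{\theta_k}$, meaning $L(u\otimes v^* )=\sum_k (\theta_k\wedge u)\otimes i_{\theta_k}(v^* )$ (no extra sign), where $i_{\theta_k}$ is the interior product on $\Lambda(V^* )$: the degree $-1$ anti-derivation with $i_{\theta_k}(\alpha)=\alpha(\theta_k)$ for $\alpha\in V^*$, $i_{\theta_k}(\alpha\wedge\beta)=(i_{\theta_k}\alpha)\wedge\beta+(-1)^{\deg\alpha}\alpha\wedge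 i_{\theta_k}\beta$, and $i_{\theta_k}=0$ on scalars. A bilinear form on a graded space $H$ is graded if $\langle H^i,H^j\rangle=0$ whenever $i\ne -j$. A degree-two linear map $L$ is a Lefschetz operator if $\langle La,b\rangle=\langle a,Lb\rangle$ for all $a,b\in H$. A bilinear form is $S_n$-equivariant if $\langle\sigma a,\sigma b\rangle=\langle a,b\rangle$ for all $\sigma\in S_n$; an operator is $S_n$-equivariant if it commutes with $S_n$. A symmetric bilinear form is $(-1)^j$-definite if $(-1)^j$ times it is positive definite (vacuously true on the zero space). *)

theory Defs
  imports "Jordan_Normal_Form.Determinant" "HOL-Analysis.Analysis"
begin

no_notation vec_index (infixl \<open>$\<close> 100)
no_notation scalar_prod (infix \<open>\<bullet>\<close> 70)

section \<open>Linear extension from the standard basis\<close>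

definition lin_ext :: "('a::finite \<Rightarrow> 'b::real_vector) \<Rightarrow> real^'a \<Rightarrow> 'b" where
  "lin_ext f u = (\<Sum>i\<in>UNIV. (u $ i) *\<^sub>R f i)"

lemma linear_lin_ext: "linear (lin_ext f)"
  by (rule linearI)
     (simp_all add: lin_ext_def scaleR_add_left sum.distrib scaleR_sum_right)

lemma lin_ext_axis [simp]: "lin_ext f (axis i 1) = f i"
proof -
  have "lin_ext f (axis i 1) = (\<Sum>j\<in>UNIV. if j = i then f i else 0)"
    unfolding lin_ext_def by (rule sum.cong) (auto simp: axis_def)
  then show ?thesis by simp
qed

lemma linear_eq_axis:
  fixes f g :: "real^'a::finite \<Rightarrow> 'b::real_vector"
  assumes f: "linear f" and g: "linear g" and eq: "\<And>i. f (axis i 1) = g (axis i 1)"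
  shows "f = g"
proof
  fix x :: "real^'a"
  have x: "x = (\<Sum>i\<in>UNIV. (x $ i) *\<^sub>R axis i 1)"
    by (simp add: Finite_Cartesian_Product.vec_eq_iff axis_def if_distrib[where f="\<lambda>z. _ * z"] cong: if_cong)
  show "f x = g x"
    by (subst (1 2) x) (simp add: linear_sum[OF f] linear_sum[OF g] linear_cmul[OF f] linear_cmul[OF g] eq)
qed

section \<open>The exterior algebra\<close>

text \<open>
  The index type \<open>'n\<close> stands for \<open>{1,\<dots>,n}\<close> with its order, so \<open>n = CARD('n)\<close>.
  \<open>V\<close> is \<open>real^'n\<close> with basis \<open>\<theta>\<^sub>k = axis k 1\<close>; its dual is again written in
  coordinates, with respect to the dual basis \<open>\<xi>\<^sub>k\<close>, so that \<open>\<alpha>(v) = \<alpha> \<bullet> v\<close>.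
  Consequently \<open>real^('n set)\<close> serves both as the exterior algebra of \<open>V\<close> and as that of the
  dual; the coordinate at \<open>I = {i\<^sub>1 < \<dots> < i\<^sub>k}\<close> is the coefficient of
  \<open>\<theta>\<^bsub>i1\<^esub> \<and> \<dots> \<and> \<theta>\<^bsub>ik\<^esub>\<close>, respectively of \<open>\<xi>\<^bsub>i1\<^esub> \<and> \<dots> \<and> \<xi>\<^bsub>ik\<^esub>\<close>
  (\<open>ext_mono_eq_wedges\<close> below).
\<close>

type_synonym 'n ext = "real^('n set)"

abbreviation ext_mono :: "'n::{finite,linorder} set \<Rightarrow> 'n ext" where
  "ext_mono I \<equiv> axis I 1"

abbreviation ext_gen :: "'n::{finite,linorder} \<Rightarrow> 'n ext" where
  "ext_gen k \<equiv> ext_mono {k}"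

definition ext_vec :: "real^'n::{finite,linorder} \<Rightarrow> 'n ext" where
  "ext_vec = lin_ext ext_gen"

definition inversions :: "'n::linorder set \<Rightarrow> 'n set \<Rightarrow> nat" where
  "inversions I J = card {(i, j). i \<in> I \<and> j \<in> J \<and> j < i}"

definition wedge_mono :: "'n::{finite,linorder} set \<Rightarrow> 'n set \<Rightarrow> 'n ext" where
  "wedge_mono I J = (if I \<inter> J = {} then (-1) ^ inversions I J *\<^sub>R ext_mono (I \<union> J) else 0)"

definition wedge :: "'n::{finite,linorder} ext \<Rightarrow> 'n ext \<Rightarrow> 'n ext" where
  "wedge u v = lin_ext (\<lambda>I. lin_ext (\<lambda>J. wedge_mono I J) v) u"

abbreviation ext_one :: "'n::{finite,linorder} ext" where
  "ext_one \<equiv> ext_mono {}"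

definition wedges :: "'n::{finite,linorder} ext list \<Rightarrow> 'n ext" where
  "wedges us = foldr wedge us ext_one"

definition ext_power :: "nat \<Rightarrow> 'n::{finite,linorder} ext set" where
  "ext_power i = span {wedges (map ext_vec vs) | vs. length vs = i}"

text \<open>
  The interior product \<open>i\<^bsub>\<theta>k\<^esub>\<close>. That it is the antiderivation determined by
  \<open>i\<^bsub>\<theta>k\<^esub>(\<alpha>) = \<alpha>(\<theta>\<^sub>k)\<close> is \<open>int_prod_one\<close>, \<open>int_prod_vec\<close>,
  \<open>int_prod_wedge\<close> and \<open>int_prod_unique\<close> below.
\<close>

definition int_prod :: "'n::{finite,linorder} \<Rightarrow> 'n ext \<Rightarrow> 'n ext" where
  "int_prod k = lin_ext (\<lambda>J. if k \<in> J
     then (-1) ^ card {j \<in> J. j < k} *\<^sub>R ext_mono (J - {k}) else 0)"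

text \<open>The matrix entry is \<open>\<xi>\<^bsub>jr\<^esub>(\<theta>\<^bsub>ic\<^esub>)\<close>; see \<open>ext_pairing_wedges\<close> for arbitrary vectors.\<close>

definition ext_pairing_mono :: "'n::{finite,linorder} set \<Rightarrow> 'n set \<Rightarrow> real" where
  "ext_pairing_mono I J = (if card I = card J
     then Determinant.det (Matrix.mat (card I) (card I)
       (\<lambda>(r, c). axis (sorted_list_of_set J ! r) (1::real) \<bullet> axis (sorted_list_of_set I ! c) 1))
     else 0)"

definition ext_pairing :: "'n::{finite,linorder} ext \<Rightarrow> 'n ext \<Rightarrow> real" where
  "ext_pairing u v = lin_ext (\<lambda>I. lin_ext (\<lambda>J. ext_pairing_mono I J) v) u"

text \<open>\<open>\<sigma>\<close> acts by \<open>\<theta>\<^sub>k \<mapsto> \<theta>\<^bsub>\<sigma>(k)\<^esub>\<close> on \<open>V\<close> and by \<open>\<xi>\<^sub>k \<mapsto> \<xi>\<^bsub>\<sigma>(k)\<^esub>\<close> on the dual, multiplicatively (\<open>ext_perm_wedge\<close>).\<close>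

definition ext_perm :: "('n::{finite,linorder} \<Rightarrow> 'n) \<Rightarrow> 'n ext \<Rightarrow> 'n ext" where
  "ext_perm \<sigma> = lin_ext (\<lambda>I. wedges (map (\<lambda>k. ext_gen (\<sigma> k)) (sorted_list_of_set I)))"

section \<open>The tensor product of the two exterior algebras\<close>

text \<open>
  \<open>tens\<close> is the canonical bilinear map into the tensor product, and \<open>tens_ext f\<close> the linear map
  induced by a bilinear map \<open>f\<close> (\<open>tens_ext_tens\<close> below).
\<close>

type_synonym 'n ext2 = "real^('n set \<times> 'n set)"

definition tens :: "'n::{finite,linorder} ext \<Rightarrow> 'n ext \<Rightarrow> 'n ext2" where
  "tens u v = (\<chi> p. u $ fst p * v $ snd p)"

definition tens_ext :: "('n::{finite,linorder} ext \<Rightarrow> 'n ext \<Rightarrow> 'b::real_vector) \<Rightarrow> 'n ext2 \<Rightarrow> 'b" where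
  "tens_ext f = lin_ext (\<lambda>(I, J). f (ext_mono I) (ext_mono J))"

text \<open>The graded space \<open>H'\<^bsub>n,m\<^esub>\<close>, given by its homogeneous pieces.\<close>

definition H' :: "nat \<Rightarrow> int \<Rightarrow> 'n::{finite,linorder} ext2 set" where
  "H' m d = span {tens u v | u v i.
     i \<le> m \<and> d = - int m + 2 * int i \<and> u \<in> ext_power i \<and> v \<in> ext_power (m - i)}"

definition eps :: "nat \<Rightarrow> nat \<Rightarrow> nat" where
  "eps n m = (if m \<le> n then m * (m - 1) div 2 else (2 * n - m) * (2 * n - m - 1) div 2)"

definition H'_form :: "nat \<Rightarrow> 'n::{finite,linorder} ext2 \<Rightarrow> 'n ext2 \<Rightarrow> real" where
  "H'_form m x y = tens_ext (\<lambda>u v. tens_ext (\<lambda>u' v'.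
     (-1) ^ eps CARD('n) m * ext_pairing u v' * ext_pairing u' v) y) x"

definition H'_L :: "'n::{finite,linorder} ext2 \<Rightarrow> 'n ext2" where
  "H'_L = tens_ext (\<lambda>u v. \<Sum>k\<in>UNIV. tens (wedge (ext_gen k) u) (int_prod k v))"

definition H'_perm :: "('n::{finite,linorder} \<Rightarrow> 'n) \<Rightarrow> 'n ext2 \<Rightarrow> 'n ext2" where
  "H'_perm \<sigma> = tens_ext (\<lambda>u v. tens (ext_perm \<sigma> u) (ext_perm \<sigma> v))"

section \<open>Graded spaces, forms and Lefschetz operators\<close>

definition total_space :: "(int \<Rightarrow> 'a::real_vector set) \<Rightarrow> 'a set" where
  "total_space G = span (\<Union>d. G d)"

definition linear_map_on :: "'a::real_vector set \<Rightarrow> ('a \<Rightarrow> 'b::real_vector) \<Rightarrow> bool" where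
  "linear_map_on S f \<longleftrightarrow>
     (\<forall>a\<in>S. \<forall>b\<in>S. f (a + b) = f a + f b) \<and> (\<forall>c. \<forall>a\<in>S. f (c *\<^sub>R a) = c *\<^sub>R f a)"

definition bilinear_form_on :: "'a::real_vector set \<Rightarrow> ('a \<Rightarrow> 'a \<Rightarrow> real) \<Rightarrow> bool" where
  "bilinear_form_on S B \<longleftrightarrow>
     (\<forall>a\<in>S. linear_map_on S (\<lambda>b. B a b)) \<and> (\<forall>b\<in>S. linear_map_on S (\<lambda>a. B a b))"

definition symmetric_bilinear_form_on :: "'a::real_vector set \<Rightarrow> ('a \<Rightarrow> 'a \<Rightarrow> real) \<Rightarrow> bool" where
  "symmetric_bilinear_form_on S B \<longleftrightarrow>
     bilinear_form_on S B \<and> (\<forall>a\<in>S. \<forall>b\<in>S. B a b = B b a)"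

definition nondegenerate_on :: "'a::real_vector set \<Rightarrow> ('a \<Rightarrow> 'a \<Rightarrow> real) \<Rightarrow> bool" where
  "nondegenerate_on S B \<longleftrightarrow>
     (\<forall>a\<in>S. (\<forall>b\<in>S. B a b = 0) \<longrightarrow> a = 0) \<and> (\<forall>b\<in>S. (\<forall>a\<in>S. B a b = 0) \<longrightarrow> b = 0)"

definition graded_form :: "(int \<Rightarrow> 'a::real_vector set) \<Rightarrow> ('a \<Rightarrow> 'a \<Rightarrow> real) \<Rightarrow> bool" where
  "graded_form G B \<longleftrightarrow> (\<forall>i j. i \<noteq> - j \<longrightarrow> (\<forall>a\<in>G i. \<forall>b\<in>G j. B a b = 0))"

definition degree_two_map :: "(int \<Rightarrow> 'a::real_vector set) \<Rightarrow> ('a \<Rightarrow> 'a) \<Rightarrow> bool" where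
  "degree_two_map G L \<longleftrightarrow> linear_map_on (total_space G) L \<and> (\<forall>i. L ` G i \<subseteq> G (i + 2))"

definition lefschetz_operator ::
    "(int \<Rightarrow> 'a::real_vector set) \<Rightarrow> ('a \<Rightarrow> 'a \<Rightarrow> real) \<Rightarrow> ('a \<Rightarrow> 'a) \<Rightarrow> bool" where
  "lefschetz_operator G B L \<longleftrightarrow>
     degree_two_map G L \<and> (\<forall>a\<in>total_space G. \<forall>b\<in>total_space G. B (L a) b = B a (L b))"

definition linear_iso_betw :: "('a::real_vector \<Rightarrow> 'b::real_vector) \<Rightarrow> 'a set \<Rightarrow> 'b set \<Rightarrow> bool" where
  "linear_iso_betw f S T \<longleftrightarrow> linear_map_on S f \<and> bij_betw f S T"

definition hard_lefschetz :: "(int \<Rightarrow> 'a::real_vector set) \<Rightarrow> ('a \<Rightarrow> 'a) \<Rightarrow> bool" where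
  "hard_lefschetz G L \<longleftrightarrow> (\<forall>i::nat. linear_iso_betw (L ^^ i) (G (- int i)) (G (int i)))"

text \<open>\<open>sign_definite_on j S B\<close> is \<open>(-1)\<^sup>j\<close>-definiteness on \<open>S\<close>; \<open>j\<close> may be negative.\<close>

definition sign_definite_on :: "int \<Rightarrow> 'a::real_vector set \<Rightarrow> ('a \<Rightarrow> 'a \<Rightarrow> real) \<Rightarrow> bool" where
  "sign_definite_on j S B \<longleftrightarrow>
     symmetric_bilinear_form_on S B \<and> (\<forall>a\<in>S. a \<noteq> 0 \<longrightarrow> (-1) powi j * B a a > 0)"

definition primitive_subspace :: "nat \<Rightarrow> nat \<Rightarrow> 'n::{finite,linorder} ext2 set" where
  "primitive_subspace m i = {a \<in> H' m (- int m + 2 * int i). (H'_L ^^ (m - 2 * i + 1)) a = 0}"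

definition lefschetz_form ::
    "nat \<Rightarrow> nat \<Rightarrow> 'n::{finite,linorder} ext2 \<Rightarrow> 'n ext2 \<Rightarrow> real" where
  "lefschetz_form m i a b = H'_form m a ((H'_L ^^ (m - 2 * i)) b)"

text \<open>The symmetric group on the index type acts through \<open>H'_perm\<close>.\<close>

definition equivariant_form_on ::
    "'n::{finite,linorder} ext2 set \<Rightarrow> ('n ext2 \<Rightarrow> 'n ext2 \<Rightarrow> real) \<Rightarrow> bool" where
  "equivariant_form_on S B \<longleftrightarrow>
     (\<forall>\<sigma>. \<sigma> permutes UNIV \<longrightarrow> (\<forall>a\<in>S. \<forall>b\<in>S. B (H'_perm \<sigma> a) (H'_perm \<sigma> b) = B a b))"

definition equivariant_map_on ::
    "'n::{finite,linorder} ext2 set \<Rightarrow> ('n ext2 \<Rightarrow> 'n ext2) \<Rightarrow> bool" where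
  "equivariant_map_on S f \<longleftrightarrow>
     (\<forall>\<sigma>. \<sigma> permutes UNIV \<longrightarrow> (\<forall>a\<in>S. f (H'_perm \<sigma> a) = H'_perm \<sigma> (f a)))"

section \<open>The constructions above have their defining properties\<close>

lemma linear_lin_ext_param:
  assumes "\<And>i. linear (\<lambda>v. F i v)"
  shows "linear (\<lambda>v. lin_ext (\<lambda>i. F i v) u)"
  unfolding lin_ext_def
  by (intro linear_compose_sum ballI linear_compose_scale_right assms)

lemma lin_ext_ident: "lin_ext (\<lambda>i. axis i 1) u = u"
proof -
  have "lin_ext (\<lambda>i. axis i 1) = (\<lambda>u :: real^'a. u)"
    by (rule linear_eq_axis) (auto simp: linear_lin_ext linear_ident)
  then show ?thesis by metis
qed

lemma bilinear_eq_axis: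
  fixes f g :: "real^'a::finite \<Rightarrow> real^'b::finite \<Rightarrow> 'c::real_vector"
  assumes "bilinear f" "bilinear g" "\<And>i j. f (axis i 1) (axis j 1) = g (axis i 1) (axis j 1)"
  shows "f = g"
proof (rule ext)
  fix x
  have "f x = g x"
  proof (rule linear_eq_axis)
    show "linear (f x)" "linear (g x)" using assms by (auto simp: bilinear_def)
    fix j
    have "(\<lambda>x. f x (axis j 1)) = (\<lambda>x. g x (axis j 1))"
      by (rule linear_eq_axis) (use assms in \<open>auto simp: bilinear_def\<close>)
    then show "f x (axis j 1) = g x (axis j 1)" by metis
  qed
  then show "f x = g x" .
qed

lemma bilinear_wedge: "bilinear wedge"
  unfolding bilinear_def wedge_def
  by (auto intro!: linear_lin_ext linear_lin_ext_param)

lemmas wedge_simps =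
  bilinear_ladd[OF bilinear_wedge] bilinear_radd[OF bilinear_wedge]
  bilinear_lmul[OF bilinear_wedge] bilinear_rmul[OF bilinear_wedge]
  bilinear_lneg[OF bilinear_wedge] bilinear_rneg[OF bilinear_wedge]
  bilinear_lzero[OF bilinear_wedge] bilinear_rzero[OF bilinear_wedge]
  bilinear_lsub[OF bilinear_wedge] bilinear_rsub[OF bilinear_wedge]

lemma linear_wedge_right: "linear (wedge u)"
  by (rule bilinear_wedge[unfolded bilinear_def, THEN conjunct1, rule_format])

lemma linear_wedge_left: "linear (\<lambda>u. wedge u v)"
  by (rule bilinear_wedge[unfolded bilinear_def, THEN conjunct2, rule_format])

lemma wedge_mono_mono [simp]: "wedge (ext_mono I) (ext_mono J) = wedge_mono I J"
  by (simp add: wedge_def)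

lemma inversions_Un_left:
  fixes I J K :: "'n::{finite,linorder} set"
  assumes "I \<inter> J = {}"
  shows "inversions (I \<union> J) K = inversions I K + inversions J K"
proof -
  have "{(i, j). i \<in> I \<union> J \<and> j \<in> K \<and> j < i} =
        {(i, j). i \<in> I \<and> j \<in> K \<and> j < i} \<union> {(i, j). i \<in> J \<and> j \<in> K \<and> j < i}"
    by auto
  then show ?thesis unfolding inversions_def
    by (simp only:) (rule card_Un_disjoint, use assms in auto)
qed

lemma inversions_Un_right:
  fixes I J K :: "'n::{finite,linorder} set"
  assumes "J \<inter> K = {}"
  shows "inversions I (J \<union> K) = inversions I J + inversions I K"
proof -
  have "{(i, j). i \<in> I \<and> j \<in> J \<union> K \<and> j < i} =
        {(i, j). i \<in> I \<and> j \<in> J \<and> j < i} \<union> {(i, j). i \<in> I \<and> j \<in> K \<and> j < i}"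
    by auto
  then show ?thesis unfolding inversions_def
    by (simp only:) (rule card_Un_disjoint, use assms in auto)
qed

lemma wedge_assoc_mono:
  "wedge (wedge_mono I J) (ext_mono K) = wedge (ext_mono I) (wedge_mono J K)"
proof (cases "I \<inter> J = {} \<and> I \<inter> K = {} \<and> J \<inter> K = {}")
  case True
  then have "I \<inter> (J \<union> K) = {}" "(I \<union> J) \<inter> K = {}" by auto
  with True show ?thesis
    by (simp add: wedge_mono_def wedge_simps inversions_Un_left inversions_Un_right
        power_add Un_assoc)
next
  case False
  then show ?thesis
    by (auto simp: wedge_mono_def wedge_simps Int_Un_distrib Int_Un_distrib2)
qed

lemma wedge_assoc: "wedge (wedge u v) w = wedge u (wedge v w)"
proof -
  have 1: "(\<lambda>w. wedge (wedge_mono I J) w) = (\<lambda>w. wedge (ext_mono I) (wedge (ext_mono J) w))" for I J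
    by (rule linear_eq_axis)
      (auto simp: wedge_assoc_mono intro!: linear_wedge_right linear_compose[OF linear_wedge_right, unfolded o_def])
  have 2: "(\<lambda>u v. wedge (wedge u v) w) = (\<lambda>u v. wedge u (wedge v w))"
  proof (rule bilinear_eq_axis)
    show "bilinear (\<lambda>u v. wedge (wedge u v) w)"
      unfolding bilinear_def
      by (auto intro!: linear_compose[OF _ linear_wedge_left, unfolded o_def] linear_wedge_right linear_wedge_left)
    show "bilinear (\<lambda>u v. wedge u (wedge v w))"
      unfolding bilinear_def
      by (auto intro!: linear_wedge_left linear_compose[OF _ linear_wedge_right, unfolded o_def])
    show "wedge (wedge (ext_mono I) (ext_mono J)) w = wedge (ext_mono I) (wedge (ext_mono J) w)" for I J
      using fun_cong[OF 1, of I J w] by simp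
  qed
  then show ?thesis by meson
qed

lemma wedge_one_left [simp]: "wedge ext_one v = v"
proof -
  have "wedge ext_one = (\<lambda>v. v)"
    by (rule linear_eq_axis)
      (auto simp: wedge_mono_def inversions_def linear_wedge_right linear_ident)
  then show ?thesis by metis
qed

lemma wedge_one_right [simp]: "wedge u ext_one = u"
proof -
  have "(\<lambda>u. wedge u ext_one) = (\<lambda>u. u)"
    by (rule linear_eq_axis)
      (auto simp: wedge_mono_def inversions_def linear_wedge_left linear_ident)
  then show ?thesis by metis
qed

lemma wedge_gen_mono:
  "wedge (ext_gen k) (ext_mono J) =
   (if k \<in> J then 0 else (-1) ^ card {j \<in> J. j < k} *\<^sub>R ext_mono (insert k J))"
proof -
  have "{(i, j). i = k \<and> j \<in> J \<and> j < i} = Pair k ` {j \<in> J. j < k}" by auto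
  then have "inversions {k} J = card {j \<in> J. j < k}"
    by (simp add: inversions_def card_image inj_on_def)
  then show ?thesis by (simp add: wedge_mono_def)
qed

lemma linear_ext_vec: "linear ext_vec"
  by (simp add: ext_vec_def linear_lin_ext)

lemma ext_vec_axis [simp]: "ext_vec (axis k 1) = ext_gen k"
  by (simp add: ext_vec_def)

lemma wedge_vec_anticomm: "wedge (ext_vec x) (ext_vec y) = - wedge (ext_vec y) (ext_vec x)"
proof -
  have "(\<lambda>x y. wedge (ext_vec x) (ext_vec y)) = (\<lambda>x y. - wedge (ext_vec y) (ext_vec x))"
  proof (rule bilinear_eq_axis)
    show "bilinear (\<lambda>x y. wedge (ext_vec x) (ext_vec y))"
      unfolding bilinear_def
      by (auto intro!: linear_compose[OF linear_ext_vec, unfolded o_def] linear_wedge_left linear_wedge_right)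
    show "bilinear (\<lambda>x y. - wedge (ext_vec y) (ext_vec x))"
      unfolding bilinear_def
      by (auto intro!: linear_compose_neg linear_compose[OF linear_ext_vec, unfolded o_def] linear_wedge_left linear_wedge_right)
    show "wedge (ext_vec (axis i 1)) (ext_vec (axis j 1)) = - wedge (ext_vec (axis j 1)) (ext_vec (axis i 1))" for i j
      by (auto simp del: wedge_mono_mono simp: wedge_gen_mono insert_commute Collect_conv_if)
  qed
  then show ?thesis by meson
qed

lemma wedge_vec_self: "wedge (ext_vec x) (ext_vec x) = 0"
proof -
  have "wedge (ext_vec x) (ext_vec x) + wedge (ext_vec x) (ext_vec x) = 0"
    by (subst wedge_vec_anticomm) simp
  then have "2 *\<^sub>R wedge (ext_vec x) (ext_vec x) = 0" by (simp only: scaleR_2)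
  then show ?thesis by simp
qed

lemma wedges_simps [simp]: "wedges [] = ext_one" "wedges (u # us) = wedge u (wedges us)"
  by (simp_all add: wedges_def)

lemma wedges_sorted_gen: "sorted_wrt (<) ks \<Longrightarrow> wedges (map ext_gen ks) = ext_mono (set ks)"
proof (induction ks)
  case (Cons k ks)
  then have "{j \<in> set ks. j < k} = {}" "k \<notin> set ks" by auto
  then have "wedge (ext_gen k) (ext_mono (set ks)) = ext_mono (insert k (set ks))"
    by (simp only: wedge_gen_mono) simp
  with Cons show ?case by simp
qed simp

lemma ext_mono_eq_wedges: "ext_mono I = wedges (map ext_gen (sorted_list_of_set I))"
  by (subst wedges_sorted_gen) auto

lemma ext_gen_wedge_anticomm:
  "wedge (ext_gen i) (wedge (ext_gen j) w) = - wedge (ext_gen j) (wedge (ext_gen i) w)"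
  using arg_cong[OF wedge_vec_anticomm[of "axis i 1" "axis j 1"], of "\<lambda>u. wedge u w"]
  by (simp only: wedge_assoc ext_vec_axis wedge_simps)

lemma linear_int_prod: "linear (int_prod k)"
  by (simp add: int_prod_def linear_lin_ext)

lemma int_prod_mono:
  "int_prod k (ext_mono J) =
   (if k \<in> J then (-1) ^ card {j \<in> J. j < k} *\<^sub>R ext_mono (J - {k}) else 0)"
  by (simp add: int_prod_def)

lemma int_prod_one: "int_prod k ext_one = 0"
  by (simp add: int_prod_mono)

lemma int_prod_vec: "int_prod k (ext_vec a) = (a \<bullet> axis k 1) *\<^sub>R ext_one"
proof -
  have "(\<lambda>a. int_prod k (ext_vec a)) = (\<lambda>a. (a \<bullet> axis k 1) *\<^sub>R ext_one)"
  proof (rule linear_eq_axis)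
    show "linear (\<lambda>a. int_prod k (ext_vec a))"
      by (rule linear_compose[OF linear_ext_vec linear_int_prod, unfolded o_def])
    show "linear (\<lambda>a. (a \<bullet> axis k 1) *\<^sub>R (ext_one :: 'a ext))"
      by (rule linearI) (simp_all add: inner_add_left scaleR_add_left)
    show "int_prod k (ext_vec (axis i 1)) = (axis i (1::real) \<bullet> axis k 1) *\<^sub>R ext_one" for i
      by (auto simp: int_prod_mono inner_axis_axis Collect_conv_if)
  qed
  then show ?thesis by meson
qed

lemma int_prod_gen_wedge:
  "int_prod k (wedge (ext_gen j) v) = (if j = k then v else 0) - wedge (ext_gen j) (int_prod k v)"
proof -
  have "(\<lambda>v. int_prod k (wedge (ext_gen j) v)) =
        (\<lambda>v. (if j = k then v else 0) - wedge (ext_gen j) (int_prod k v))"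
  proof (rule linear_eq_axis)
    show "linear (\<lambda>v. int_prod k (wedge (ext_gen j) v))"
      by (rule linear_compose[OF linear_wedge_right linear_int_prod, unfolded o_def])
    show "linear (\<lambda>v. (if j = k then v else 0) - wedge (ext_gen j) (int_prod k v))"
      by (cases "j = k") (auto intro!: linear_compose_sub linear_ident linear_zero linear_compose_neg
          linear_compose[OF linear_int_prod linear_wedge_right, unfolded o_def])
    fix J :: "'a set"
    show "int_prod k (wedge (ext_gen j) (ext_mono J)) =
       (if j = k then ext_mono J else 0) - wedge (ext_gen j) (int_prod k (ext_mono J))"
    proof (cases "j = k")
      case True
      have "{i \<in> insert k J. i < k} = {i \<in> J. i < k}" "{i \<in> J - {k}. i < k} = {i \<in> J. i < k}"
        by auto
      moreover have "k \<in> J \<Longrightarrow> insert k J = J" by auto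
      ultimately show ?thesis using True
        by (simp del: wedge_mono_mono add: wedge_gen_mono int_prod_mono linear_cmul[OF linear_int_prod]
            linear_0[OF linear_int_prod] wedge_simps flip: power_add)
    next
      case False
      consider "k \<notin> J" | "k \<in> J" "j \<in> J" | "k \<in> J" "j \<notin> J" by blast
      then show ?thesis
      proof cases
        case 3
        have A: "card {i. (i = j \<or> i \<in> J) \<and> i < k} = card {i \<in> J. i < k} + (if j < k then 1 else 0)"
        proof -
          have "{i. (i = j \<or> i \<in> J) \<and> i < k} = (if j < k then insert j {i \<in> J. i < k} else {i \<in> J. i < k})"
            by auto
          then show ?thesis using 3 by simp
        qed
        have B: "card {i \<in> J. i < j} = card {i \<in> J. i \<noteq> k \<and> i < j} + (if k < j then 1 else 0)"
        proof -
          have "{i \<in> J. i < j} = (if k < j then insert k {i \<in> J. i \<noteq> k \<and> i < j} else {i \<in> J. i \<noteq> k \<and> i < j})"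
            using 3 by auto
          then show ?thesis by simp
        qed
        have C: "insert j J - {k} = insert j (J - {k})" using False by auto
        have D: "j < k \<longleftrightarrow> \<not> k < j" using False by auto
        show ?thesis using 3 False
          by (simp del: wedge_mono_mono add: wedge_gen_mono int_prod_mono linear_cmul[OF linear_int_prod]
            wedge_simps A B C D power_add)
      qed (use False in \<open>auto simp del: wedge_mono_mono simp: wedge_gen_mono int_prod_mono
          linear_cmul[OF linear_int_prod] linear_0[OF linear_int_prod] wedge_simps\<close>)
    qed
  qed
  then show ?thesis by meson
qed

lemma int_prod_vec_wedge:
  "int_prod k (wedge (ext_vec a) v) = (a \<bullet> axis k 1) *\<^sub>R v - wedge (ext_vec a) (int_prod k v)"
proof -
  have "(\<lambda>a. int_prod k (wedge (ext_vec a) v)) =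
        (\<lambda>a. (a \<bullet> axis k 1) *\<^sub>R v - wedge (ext_vec a) (int_prod k v))"
  proof (rule linear_eq_axis)
    show "linear (\<lambda>a. int_prod k (wedge (ext_vec a) v))"
      by (rule linear_compose[OF linear_compose[OF linear_ext_vec linear_wedge_left] linear_int_prod, unfolded o_def])
    show "linear (\<lambda>a. (a \<bullet> axis k 1) *\<^sub>R v - wedge (ext_vec a) (int_prod k v))"
      by (rule linearI) (simp_all add: inner_add_left scaleR_add_left wedge_simps linear_add[OF linear_ext_vec]
         linear_cmul[OF linear_ext_vec] algebra_simps)
  qed (auto simp: int_prod_gen_wedge inner_axis_axis)
  then show ?thesis by meson
qed

lemma int_prod_wedge:
  assumes "u \<in> ext_power p"
  shows "int_prod k (wedge u v) = wedge (int_prod k u) v + (-1) ^ p *\<^sub>R wedge u (int_prod k v)"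
  using assms unfolding ext_power_def
proof (induction rule: span_induct_alt)
  case base
  then show ?case by (simp add: wedge_simps linear_0[OF linear_int_prod])
next
  case (step c x y)
  from step(1) obtain xs where x: "x = wedges (map ext_vec xs)" "length xs = p" by auto
  have "int_prod k (wedge (wedges (map ext_vec xs)) v) =
     wedge (int_prod k (wedges (map ext_vec xs))) v +
      (-1) ^ length xs *\<^sub>R wedge (wedges (map ext_vec xs)) (int_prod k v)"
    by (induction xs)
       (simp_all add: int_prod_one int_prod_vec_wedge wedge_assoc wedge_simps algebra_simps)
  with x step(2) show ?case
    by (simp add: wedge_simps linear_add[OF linear_int_prod] linear_cmul[OF linear_int_prod] algebra_simps)
qed

lemma ext_power_0: "ext_one \<in> ext_power 0"
  unfolding ext_power_def by (rule span_base) force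

lemma ext_power_vec: "ext_vec x \<in> ext_power 1"
  unfolding ext_power_def by (rule span_base) (force intro: exI[of _ "[x]"])

lemma int_prod_unique:
  assumes "linear D" "D ext_one = 0" "\<And>a. D (ext_vec a) = (a \<bullet> axis k 1) *\<^sub>R ext_one"
    and "\<And>p u v. u \<in> ext_power p \<Longrightarrow> D (wedge u v) = wedge (D u) v + (-1) ^ p *\<^sub>R wedge u (D v)"
  shows "D = int_prod k"
proof (rule linear_eq_axis[OF assms(1) linear_int_prod])
  fix I
  have "D (wedges (map ext_vec vs)) = int_prod k (wedges (map ext_vec vs))" for vs
    by (induction vs)
       (simp_all add: assms(2,3) assms(4)[OF ext_power_vec] int_prod_wedge[OF ext_power_vec] int_prod_one int_prod_vec)
  from this[of "map (\<lambda>k. axis k 1) (sorted_list_of_set I)"]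
  show "D (ext_mono I) = int_prod k (ext_mono I)"
    by (simp add: o_def flip: ext_mono_eq_wedges)
qed

lemma ext_power_iff: "u \<in> ext_power i \<longleftrightarrow> (\<forall>I. u $ I \<noteq> 0 \<longrightarrow> card I = i)"
proof
  have card_wedges: "card I = length vs" if "wedges (map ext_vec vs) $ I \<noteq> 0" for vs and I :: "'a set"
    using that
  proof (induction vs arbitrary: I)
    case (Cons v vs)
    define w where "w = wedges (map ext_vec vs)"
    have "w = (\<Sum>J\<in>UNIV. w $ J *\<^sub>R ext_mono J)"
      using lin_ext_ident[of w, symmetric] by (simp only: lin_ext_def)
    then have "wedge (ext_gen k) w = (\<Sum>J\<in>UNIV. w $ J *\<^sub>R wedge (ext_gen k) (ext_mono J))" for k
    proof -
      assume w: "w = (\<Sum>J\<in>UNIV. w $ J *\<^sub>R ext_mono J)"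
      show ?thesis
        using arg_cong[OF w, of "wedge (ext_gen k)"]
        by (simp only: linear_sum[OF linear_wedge_right] linear_cmul[OF linear_wedge_right])
    qed
    moreover have "wedge (ext_vec v) w = (\<Sum>k\<in>UNIV. v $ k *\<^sub>R wedge (ext_gen k) w)"
      by (simp only: ext_vec_def lin_ext_def linear_sum[OF linear_wedge_left] wedge_simps)
    ultimately have "wedge (ext_vec v) w =
        (\<Sum>k\<in>UNIV. v $ k *\<^sub>R (\<Sum>J\<in>UNIV. w $ J *\<^sub>R wedge (ext_gen k) (ext_mono J)))"
      by (simp only:)
    then have "(\<Sum>k\<in>UNIV. v $ k * (\<Sum>J\<in>UNIV. w $ J * wedge (ext_gen k) (ext_mono J) $ I)) \<noteq> 0"
      using Cons.prems by (simp del: wedge_mono_mono add: w_def)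
    then obtain k J where "w $ J \<noteq> 0" "wedge (ext_gen k) (ext_mono J) $ I \<noteq> 0"
      by (metis (mono_tags, lifting) mult_eq_0_iff sum.neutral)
    moreover from this(2) have "k \<notin> J" "I = insert k J"
      unfolding wedge_gen_mono by (auto simp: axis_def split: if_splits)
    ultimately show ?case using Cons.IH[of J] by (simp add: w_def)
  qed (auto simp: axis_def split: if_splits)
  assume "u \<in> ext_power i"
  then show "\<forall>I. u $ I \<noteq> 0 \<longrightarrow> card I = i"
    unfolding ext_power_def
  proof (induction rule: span_induct_alt)
    case (step c x y)
    then obtain vs where "x = wedges (map ext_vec vs)" "length vs = i" by auto
    then have "\<forall>I. x $ I \<noteq> 0 \<longrightarrow> card I = i" using card_wedges by auto
    with step(2) show ?case by (metis add.right_neutral mult_eq_0_iff vector_add_component vector_scaleR_component real_scaleR_def)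
  qed simp
next
  assume u: "\<forall>I. u $ I \<noteq> 0 \<longrightarrow> card I = i"
  have "(\<Sum>I\<in>UNIV. u $ I *\<^sub>R ext_mono I) \<in> ext_power i"
    unfolding ext_power_def
  proof (rule span_sum)
    fix I :: "'a set"
    have "ext_mono I = wedges (map ext_vec (map (\<lambda>k. axis k 1) (sorted_list_of_set I)))"
      by (subst ext_mono_eq_wedges) (simp add: o_def)
    then have "u $ I \<noteq> 0 \<Longrightarrow> ext_mono I \<in> span {wedges (map ext_vec vs) |vs. length vs = i}"
      using u by (intro span_base CollectI exI[of _ "map (\<lambda>k. axis k 1) (sorted_list_of_set I)"]) auto
    then show "u $ I *\<^sub>R ext_mono I \<in> span {wedges (map ext_vec vs) |vs. length vs = i}"
      by (cases "u $ I = 0") (auto intro: span_scale span_zero)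
  qed
  then show "u \<in> ext_power i" by (simp add: lin_ext_ident[unfolded lin_ext_def])
qed

lemma ext_pairing_mono_eq: "ext_pairing_mono I J = (if I = J then 1 else 0)"
proof (cases "card I = card J")
  case True
  let ?k = "card I"
  let ?is = "sorted_list_of_set I" and ?js = "sorted_list_of_set J"
  let ?A = "Matrix.mat ?k ?k (\<lambda>(r, c). axis (?js ! r) (1::real) \<bullet> axis (?is ! c) 1)"
  have len: "length ?is = ?k" "length ?js = ?k" using True by auto
  show ?thesis
  proof (cases "I = J")
    case eq: True
    have "?A = 1\<^sub>m ?k"
      by (rule eq_matI) (use len eq in \<open>auto simp: inner_axis_axis nth_eq_iff_index_eq\<close>)
    with eq show ?thesis by (simp add: ext_pairing_mono_def)
  next
    case False
    then have "\<not> J \<subseteq> I" using True card_subset_eq[of I J] by auto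
    then obtain j where "j \<in> J" "j \<notin> I" by auto
    then obtain r where r: "r < ?k" "?js ! r = j"
      using len by (metis finite in_set_conv_nth set_sorted_list_of_set)
    have nj: "?is ! c \<noteq> j" if "c < ?k" for c
      using that len \<open>j \<notin> I\<close> by (metis finite nth_mem set_sorted_list_of_set)
    then have "?A $$ (r, c) = 0" if "c < ?k" for c
      using that r nj[OF that, symmetric] by (simp add: inner_axis_axis)
    then have "Determinant.det ?A = 0"
      by (subst laplace_expansion_row[OF _ r(1)]) auto
    with True False show ?thesis by (simp add: ext_pairing_mono_def)
  qed
qed (auto simp: ext_pairing_mono_def)

lemma ext_pairing_eq_inner: "ext_pairing u v = u \<bullet> v"
  by (simp add: ext_pairing_def ext_pairing_mono_eq lin_ext_def inner_vec_def if_distrib cong: if_cong)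

lemma int_prod_adjoint: "wedge (ext_gen k) u \<bullet> v = u \<bullet> int_prod k v"
proof -
  have "(\<lambda>u v. wedge (ext_gen k) u \<bullet> v) = (\<lambda>u v. u \<bullet> int_prod k v)"
  proof (rule bilinear_eq_axis)
    show "bilinear (\<lambda>u v. wedge (ext_gen k) u \<bullet> v)"
      by (auto simp: bilinear_def wedge_simps inner_add_left inner_add_right intro!: linearI)
    show "bilinear (\<lambda>u v. u \<bullet> int_prod k v)"
      by (auto simp: bilinear_def inner_add_left inner_add_right linear_add[OF linear_int_prod]
          linear_cmul[OF linear_int_prod] intro!: linearI)
    fix I J :: "'a set"
    show "wedge (ext_gen k) (ext_mono I) \<bullet> ext_mono J = ext_mono I \<bullet> int_prod k (ext_mono J)"
    proof (cases "k \<notin> I \<and> J = insert k I")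
      case True
      then have "{j \<in> J. j < k} = {j \<in> I. j < k}" "J - {k} = I" "k \<in> J" by auto
      then show ?thesis using True by (simp only: wedge_gen_mono int_prod_mono) (simp add: inner_axis_axis)
    next
      case False
      then have "wedge (ext_gen k) (ext_mono I) \<bullet> ext_mono J = 0"
        by (auto simp del: wedge_mono_mono simp: wedge_gen_mono inner_axis_axis)
      moreover from False have "k \<in> J \<Longrightarrow> I \<noteq> J - {k}" by auto
      then have "ext_mono I \<bullet> int_prod k (ext_mono J) = 0"
        by (auto simp: int_prod_mono inner_axis_axis)
      ultimately show ?thesis by simp
    qed
  qed
  then show ?thesis by meson
qed

lemma inner_one_wedge: "ext_one \<bullet> wedge (ext_vec a) w = 0"
proof -
  have "(\<lambda>a. ext_one \<bullet> wedge (ext_vec a) w) = (\<lambda>a. 0)"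
  proof (rule linear_eq_axis)
    show "linear (\<lambda>a. ext_one \<bullet> wedge (ext_vec a) w)"
      by (rule linearI) (simp_all add: wedge_simps linear_add[OF linear_ext_vec]
          linear_cmul[OF linear_ext_vec] inner_add_right)
    show "ext_one \<bullet> wedge (ext_vec (axis i 1)) w = 0" for i
      using int_prod_adjoint[of i w ext_one] by (simp add: int_prod_one inner_commute)
  qed (auto simp: linear_zero)
  then show ?thesis by meson
qed

definition int_prod_by :: "real^'n::{finite,linorder} \<Rightarrow> 'n ext \<Rightarrow> 'n ext" where
  "int_prod_by x v = (\<Sum>k\<in>UNIV. x $ k *\<^sub>R int_prod k v)"

lemma int_prod_by_adjoint: "wedge (ext_vec x) u \<bullet> v = u \<bullet> int_prod_by x v"
  by (simp add: ext_vec_def lin_ext_def int_prod_by_def linear_sum[OF linear_wedge_left] wedge_simps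
      inner_sum_left inner_sum_right int_prod_adjoint)

lemma int_prod_by_one: "int_prod_by x ext_one = 0"
  by (simp add: int_prod_by_def int_prod_one)

lemma int_prod_by_vec_wedge:
  "int_prod_by x (wedge (ext_vec a) v) = (a \<bullet> x) *\<^sub>R v - wedge (ext_vec a) (int_prod_by x v)"
proof -
  have "(a \<bullet> x) = (\<Sum>k\<in>UNIV. x $ k * (a \<bullet> axis k 1))"
    by (simp add: inner_vec_def[of a x] inner_axis mult.commute)
  then show ?thesis
    by (simp add: int_prod_by_def int_prod_vec_wedge linear_sum[OF linear_wedge_right] wedge_simps
        scaleR_diff_right sum_subtractf flip: scaleR_sum_left)
qed

lemma int_prod_by_wedges:
  "int_prod_by x (wedges (map ext_vec vs)) =
   (\<Sum>r<length vs. ((-1) ^ r * (vs ! r \<bullet> x)) *\<^sub>R wedges (map ext_vec (take r vs @ drop (Suc r) vs)))"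
proof (induction vs)
  case (Cons v vs)
  show ?case
    by (simp add: int_prod_by_vec_wedge Cons.IH sum.lessThan_Suc_shift linear_sum[OF linear_wedge_right]
        wedge_simps sum_negf del: sum.lessThan_Suc)
qed (simp add: int_prod_by_one)

lemma ext_pairing_wedges:
  "ext_pairing (wedges (map ext_vec us)) (wedges (map ext_vec vs)) =
   (if length us = length vs
    then Determinant.det (Matrix.mat (length us) (length us) (\<lambda>(r, c). vs ! r \<bullet> us ! c))
    else 0)"
proof (induction us arbitrary: vs)
  case Nil
  show ?case
    by (cases vs) (simp_all add: ext_pairing_eq_inner inner_one_wedge inner_axis_axis)
next
  case (Cons u us)
  let ?del = "\<lambda>r. take r vs @ drop (Suc r) vs"
  have eq: "ext_pairing (wedges (map ext_vec (u # us))) (wedges (map ext_vec vs)) =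
     (\<Sum>r<length vs. (-1) ^ r * (vs ! r \<bullet> u) *
        ext_pairing (wedges (map ext_vec us)) (wedges (map ext_vec (?del r))))"
    by (simp add: ext_pairing_eq_inner int_prod_by_adjoint int_prod_by_wedges inner_sum_right)
  have len: "length (?del r) = length vs - 1" if "r < length vs" for r
    using that by auto
  show ?case
  proof (cases "length vs = Suc (length us)")
    case False
    then have "length us \<noteq> length (?del r)" if "r < length vs" for r using len that by auto
    then have "(\<Sum>r<length vs. (-1) ^ r * (vs ! r \<bullet> u) *
        ext_pairing (wedges (map ext_vec us)) (wedges (map ext_vec (?del r)))) = 0"
      by (intro sum.neutral) (simp only: Cons.IH, simp)
    then show ?thesis unfolding eq using False by simp
  next
    case True
    let ?n = "length us"
    let ?A = "Matrix.mat (Suc ?n) (Suc ?n) (\<lambda>(r, c). vs ! r \<bullet> (u # us) ! c)"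
    have del: "Matrix.mat ?n ?n (\<lambda>(i, c). ?del r ! i \<bullet> us ! c) = mat_delete ?A r 0"
      if "r < Suc ?n" for r
      by (rule eq_matI) (use that True in \<open>auto simp: mat_delete_def nth_append min_def\<close>)
    have "Determinant.det ?A = (\<Sum>r<Suc ?n. ?A $$ (r, 0) * cofactor ?A r 0)"
      by (rule laplace_expansion_column) auto
    also have "\<dots> = (\<Sum>r<length vs. (-1) ^ r * (vs ! r \<bullet> u) *
        ext_pairing (wedges (map ext_vec us)) (wedges (map ext_vec (?del r))))"
      unfolding True
    proof (rule sum.cong[OF refl])
      fix r assume "r \<in> {..<Suc ?n}"
      then have r: "r < Suc ?n" by simp
      have "ext_pairing (wedges (map ext_vec us)) (wedges (map ext_vec (?del r))) =
          Determinant.det (mat_delete ?A r 0)"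
        using len[of r] r True by (simp only: Cons.IH del) simp
      then show "?A $$ (r, 0) * cofactor ?A r 0 = (-1) ^ r * (vs ! r \<bullet> u) *
          ext_pairing (wedges (map ext_vec us)) (wedges (map ext_vec (?del r)))"
        using r by (simp add: cofactor_def)
    qed
    finally show ?thesis unfolding eq using True by simp
  qed
qed

lemma linear_ext_perm: "linear (ext_perm \<sigma>)"
  by (simp add: ext_perm_def linear_lin_ext)

lemma wedge_gen_wedges_mem:
  "k \<in> set ks \<Longrightarrow> wedge (ext_gen k) (wedges (map ext_gen ks)) = 0"
proof (induction ks)
  case (Cons j ks)
  show ?case
  proof (cases "k = j")
    case True
    have "wedge (ext_gen k) (ext_gen k) = 0" using wedge_vec_self[of "axis k 1"] by simp
    then show ?thesis using True by (simp only: list.map wedges_simps wedge_simps flip: wedge_assoc)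
  next
    case False
    then show ?thesis using Cons by (simp add: ext_gen_wedge_anticomm[of k j] wedge_simps)
  qed
qed simp

lemma wedges_insort:
  assumes "sorted ks" "k \<notin> set ks" "distinct ks"
  shows "wedges (map (\<lambda>k. ext_gen (\<sigma> k)) (insort k ks)) =
     (-1) ^ card {j \<in> set ks. j < k} *\<^sub>R wedge (ext_gen (\<sigma> k)) (wedges (map (\<lambda>k. ext_gen (\<sigma> k)) ks))"
  using assms
proof (induction ks)
  case (Cons j ks)
  show ?case
  proof (cases "k \<le> j")
    case True
    then have *: "{i. (i = j \<or> i \<in> set ks) \<and> i < k} = {}" using Cons.prems by auto
    show ?thesis using True by (simp add: *)
  next
    case False
    then have "{i. (i = j \<or> i \<in> set ks) \<and> i < k} = insert j {i \<in> set ks. i < k}" by auto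
    then have *: "card {i. (i = j \<or> i \<in> set ks) \<and> i < k} = Suc (card {i \<in> set ks. i < k})"
      using Cons.prems by simp
    show ?thesis using False Cons
      by (simp add: * wedge_simps ext_gen_wedge_anticomm[of "\<sigma> k" "\<sigma> j"])
  qed
qed simp

lemma ext_perm_mono:
  "ext_perm \<sigma> (ext_mono I) = wedges (map (\<lambda>k. ext_gen (\<sigma> k)) (sorted_list_of_set I))"
  by (simp add: ext_perm_def)

lemma ext_perm_gen [simp]: "ext_perm \<sigma> (ext_gen k) = ext_gen (\<sigma> k)"
  by (simp add: ext_perm_mono)

lemma ext_perm_one [simp]: "ext_perm \<sigma> ext_one = ext_one"
  by (simp add: ext_perm_mono)

lemma ext_perm_gen_wedge:
  "ext_perm \<sigma> (wedge (ext_gen k) v) = wedge (ext_gen (\<sigma> k)) (ext_perm \<sigma> v)"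
proof -
  have "(\<lambda>v. ext_perm \<sigma> (wedge (ext_gen k) v)) = (\<lambda>v. wedge (ext_gen (\<sigma> k)) (ext_perm \<sigma> v))"
  proof (rule linear_eq_axis)
    show "linear (\<lambda>v. ext_perm \<sigma> (wedge (ext_gen k) v))"
      by (rule linear_compose[OF linear_wedge_right linear_ext_perm, unfolded o_def])
    show "linear (\<lambda>v. wedge (ext_gen (\<sigma> k)) (ext_perm \<sigma> v))"
      by (rule linear_compose[OF linear_ext_perm linear_wedge_right, unfolded o_def])
    fix J :: "'a set"
    show "ext_perm \<sigma> (wedge (ext_gen k) (ext_mono J)) = wedge (ext_gen (\<sigma> k)) (ext_perm \<sigma> (ext_mono J))"
    proof (cases "k \<in> J")
      case True
      then have "wedge (ext_gen (\<sigma> k)) (wedges (map ext_gen (map \<sigma> (sorted_list_of_set J)))) = 0"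
        by (intro wedge_gen_wedges_mem) auto
      then have "wedge (ext_gen (\<sigma> k)) (ext_perm \<sigma> (ext_mono J)) = 0"
        by (simp add: ext_perm_mono o_def)
      with True show ?thesis
        by (simp del: wedge_mono_mono add: wedge_gen_mono linear_0[OF linear_ext_perm])
    next
      case False
      then have "sorted_list_of_set (insert k J) = insort k (sorted_list_of_set J)"
        by (simp add: sorted_list_of_set_insert_remove)
      with False show ?thesis
        by (simp del: wedge_mono_mono add: wedge_gen_mono linear_cmul[OF linear_ext_perm] ext_perm_mono
            wedges_insort flip: power_add)
    qed
  qed
  then show ?thesis by meson
qed

lemma ext_perm_wedge: "ext_perm \<sigma> (wedge u v) = wedge (ext_perm \<sigma> u) (ext_perm \<sigma> v)"
proof -
  have "(\<lambda>u. ext_perm \<sigma> (wedge u v)) = (\<lambda>u. wedge (ext_perm \<sigma> u) (ext_perm \<sigma> v))"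
  proof (rule linear_eq_axis)
    show "linear (\<lambda>u. ext_perm \<sigma> (wedge u v))"
      by (rule linear_compose[OF linear_wedge_left linear_ext_perm, unfolded o_def])
    show "linear (\<lambda>u. wedge (ext_perm \<sigma> u) (ext_perm \<sigma> v))"
      by (rule linear_compose[OF linear_ext_perm linear_wedge_left, unfolded o_def])
    have "ext_perm \<sigma> (wedge (wedges (map ext_gen ks)) v) =
        wedge (ext_perm \<sigma> (wedges (map ext_gen ks))) (ext_perm \<sigma> v)" for ks
      by (induction ks) (simp_all add: wedge_assoc ext_perm_gen_wedge)
    from this[of "sorted_list_of_set I" for I]
    show "ext_perm \<sigma> (wedge (ext_mono I) v) = wedge (ext_perm \<sigma> (ext_mono I)) (ext_perm \<sigma> v)" for I
      by (simp only: flip: ext_mono_eq_wedges)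
  qed
  then show ?thesis by meson
qed

lemma ext_perm_wedges: "ext_perm \<sigma> (wedges us) = wedges (map (ext_perm \<sigma>) us)"
  by (induction us) (simp_all add: ext_perm_wedge)

lemma ext_perm_compose: "ext_perm (\<lambda>k. \<sigma> (\<tau> k)) u = ext_perm \<sigma> (ext_perm \<tau> u)"
proof -
  have "ext_perm (\<lambda>k. \<sigma> (\<tau> k)) = (\<lambda>u. ext_perm \<sigma> (ext_perm \<tau> u))"
    by (rule linear_eq_axis)
       (simp_all add: ext_perm_mono ext_perm_wedges o_def linear_ext_perm
          linear_compose[OF linear_ext_perm linear_ext_perm, unfolded o_def])
  then show ?thesis by metis
qed

lemma ext_perm_ident: "ext_perm (\<lambda>k. k) (u :: 'n::{finite,linorder} ext) = u"
proof -
  have "ext_perm (\<lambda>k. k) = (\<lambda>u :: 'n ext. u)"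
  proof (rule linear_eq_axis)
    show "ext_perm (\<lambda>k. k) (ext_mono I) = ext_mono I" for I :: "'n set"
      by (subst (2) ext_mono_eq_wedges) (rule ext_perm_mono)
  qed (rule linear_ext_perm linear_ident)+
  then show ?thesis by metis
qed

lemma ext_perm_vec: "ext_perm \<sigma> (ext_vec x) = ext_vec (lin_ext (\<lambda>k. axis (\<sigma> k) 1) x)"
proof -
  have "(\<lambda>x. ext_perm \<sigma> (ext_vec x)) = (\<lambda>x. ext_vec (lin_ext (\<lambda>k. axis (\<sigma> k) 1) x))"
  proof (rule linear_eq_axis)
    show "linear (\<lambda>x. ext_perm \<sigma> (ext_vec x))"
      by (rule linear_compose[OF linear_ext_vec linear_ext_perm, unfolded o_def])
    show "linear (\<lambda>x. ext_vec (lin_ext (\<lambda>k. axis (\<sigma> k) 1) x))"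
      by (rule linear_compose[OF linear_lin_ext linear_ext_vec, unfolded o_def])
  qed simp
  then show ?thesis by meson
qed

lemma ext_perm_power: "u \<in> ext_power i \<Longrightarrow> ext_perm \<sigma> u \<in> ext_power i"
  unfolding ext_power_def
proof (induction rule: span_induct_alt)
  case (step c x y)
  then obtain vs where vs: "x = wedges (map ext_vec vs)" "length vs = i" by auto
  have "ext_perm \<sigma> x = wedges (map ext_vec (map (lin_ext (\<lambda>k. axis (\<sigma> k) 1)) vs))"
    by (simp add: vs ext_perm_wedges o_def ext_perm_vec)
  with vs have "ext_perm \<sigma> x \<in> span {wedges (map ext_vec vs) |vs. length vs = i}"
    by (intro span_base CollectI) (metis length_map)
  with step(2) show ?case
    by (auto simp: linear_add[OF linear_ext_perm] linear_cmul[OF linear_ext_perm] intro!: span_add span_scale)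
qed (simp add: linear_0[OF linear_ext_perm] span_zero)

lemma bilinear_tens: "bilinear tens"
  by (auto simp: bilinear_def tens_def Finite_Cartesian_Product.vec_eq_iff algebra_simps intro!: linearI)

lemma tens_mono: "tens (ext_mono I) (ext_mono J) = axis (I, J) 1"
  by (auto simp: tens_def Finite_Cartesian_Product.vec_eq_iff axis_def)

lemma linear_tens_ext: "linear (tens_ext f)"
  by (simp add: tens_ext_def linear_lin_ext)

lemma tens_ext_tens:
  assumes f: "bilinear f"
  shows "tens_ext f (tens u v) = f u v"
proof -
  have "(\<lambda>u v. tens_ext f (tens u v)) = f"
  proof (rule bilinear_eq_axis[OF _ f])
    show "bilinear (\<lambda>u v. tens_ext f (tens u v))"
      unfolding bilinear_def
      by (intro conjI allI linear_compose[OF _ linear_tens_ext, unfolded o_def]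
          bilinear_tens[unfolded bilinear_def, THEN conjunct1, rule_format]
          bilinear_tens[unfolded bilinear_def, THEN conjunct2, rule_format])
  qed (simp add: tens_mono, simp add: tens_ext_def)
  then show ?thesis by (simp add: fun_eq_iff)
qed

lemma tens_ext_unique:
  assumes g: "linear g" and "\<And>u v. g (tens u v) = f u v"
  shows "g = tens_ext f"
  by (rule linear_eq_axis[OF g linear_tens_ext])
     (auto simp: tens_ext_def assms(2) simp flip: tens_mono)

lemma ext_pairing_bilinear: "bilinear ext_pairing"
  by (auto simp: bilinear_def ext_pairing_eq_inner inner_add_left inner_add_right intro!: linearI)

lemma H'_form_tens:
  fixes u v u' v' :: "'n::{finite,linorder} ext"
  shows "H'_form m (tens u v) (tens u' v') =
    (-1) ^ eps CARD('n) m * ext_pairing u v' * ext_pairing u' v"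
proof -
  have "bilinear (\<lambda>u' v'. (-1) ^ eps CARD('n) m * ext_pairing u v' * ext_pairing u' v)" for u v :: "'n ext"
    by (auto simp: bilinear_def ext_pairing_eq_inner inner_add_left inner_add_right algebra_simps intro!: linearI)
  note * = tens_ext_tens[OF this]
  have "bilinear (\<lambda>u v. (-1) ^ eps CARD('n) m * ext_pairing u v' * ext_pairing u' v)"
    by (auto simp: bilinear_def ext_pairing_eq_inner inner_add_left inner_add_right algebra_simps intro!: linearI)
  from tens_ext_tens[OF this] show ?thesis
    unfolding H'_form_def * .
qed

lemma bilinear_H'_form: "bilinear (H'_form m)"
  unfolding bilinear_def H'_form_def
proof (intro conjI allI)
  fix x y :: "'a ext2"
  let ?F = "\<lambda>u v u' v' :: 'a ext. (-1) ^ eps CARD('a) m * ext_pairing u v' * ext_pairing u' v"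
  show "linear (\<lambda>y. tens_ext (\<lambda>u v. tens_ext (?F u v) y) x)"
    unfolding tens_ext_def[of "\<lambda>u v. tens_ext (?F u v) _"]
    by (rule linear_lin_ext_param) (unfold case_prod_unfold, rule linear_tens_ext)
  show "linear (\<lambda>x. tens_ext (\<lambda>u v. tens_ext (?F u v) y) x)"
    by (rule linear_tens_ext)
qed

lemma H'_L_tens: "H'_L (tens u v) = (\<Sum>k\<in>UNIV. tens (wedge (ext_gen k) u) (int_prod k v))"
  unfolding H'_L_def
  by (rule tens_ext_tens)
     (auto simp: bilinear_def wedge_simps linear_add[OF linear_int_prod] linear_cmul[OF linear_int_prod]
        bilinear_ladd[OF bilinear_tens] bilinear_radd[OF bilinear_tens]
        bilinear_lmul[OF bilinear_tens] bilinear_rmul[OF bilinear_tens]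
        sum.distrib scaleR_sum_right intro!: linearI)

lemma H'_perm_tens: "H'_perm \<sigma> (tens u v) = tens (ext_perm \<sigma> u) (ext_perm \<sigma> v)"
  unfolding H'_perm_def
  by (rule tens_ext_tens)
     (auto simp: bilinear_def linear_add[OF linear_ext_perm] linear_cmul[OF linear_ext_perm]
        bilinear_ladd[OF bilinear_tens] bilinear_radd[OF bilinear_tens]
        bilinear_lmul[OF bilinear_tens] bilinear_rmul[OF bilinear_tens] intro!: linearI)

lemma linear_H'_L: "linear H'_L"
  by (simp add: H'_L_def linear_tens_ext)

lemma linear_H'_perm: "linear (H'_perm \<sigma>)"
  by (simp add: H'_perm_def linear_tens_ext)

lemma H'_perm_H': "x \<in> H' m d \<Longrightarrow> H'_perm \<sigma> x \<in> H' m d"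
  unfolding H'_def
proof (induction rule: span_induct_alt)
  case (step c x y)
  then obtain u v i where x: "x = tens u v" "i \<le> m" "d = - int m + 2 * int i"
    "u \<in> ext_power i" "v \<in> ext_power (m - i)" by blast
  have "H'_perm \<sigma> x \<in> span {tens u v |u v i. i \<le> m \<and> d = - int m + 2 * int i \<and>
      u \<in> ext_power i \<and> v \<in> ext_power (m - i)}"
    by (rule span_base, rule CollectI, rule exI[of _ "ext_perm \<sigma> u"],
        rule exI[of _ "ext_perm \<sigma> v"], rule exI[of _ i])
       (intro conjI x(2,3) ext_perm_power[OF x(4)] ext_perm_power[OF x(5)], simp add: x(1) H'_perm_tens)
  then show ?case
    unfolding linear_add[OF linear_H'_perm] linear_cmul[OF linear_H'_perm]
    by (rule span_add[OF span_scale step(2)])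
qed (simp add: linear_0[OF linear_H'_perm] span_zero)

end

theory Submission
  imports Defs
begin

text \<open>
  In coordinates \<open>x(I, J)\<close> the form is \<open>\<plusminus>\<close> the standard inner product with one argument
  transposed, \<open>(I, J) \<mapsto> (J, I)\<close> (\<open>H'_form_eq_inner\<close>), and \<open>L\<close> sums, with signs, over the
  ways of moving one element between the two index sets (\<open>H'_L_nth\<close>). Symmetry, grading,
  non-degeneracy and the Lefschetz property follow at once; invariance under \<open>S\<^sub>n\<close> holds because
  permutations act orthogonally on the exterior algebra and contraction is adjoint to
  exterior multiplication.

  For the other statements the signs in \<open>L\<close> are removed first. The sign with which
  \<open>k\<close> moves depends only on \<open>k\<close> and on the symmetric difference of \<open>I\<close> and \<open>J\<close>, which the move does not
  change. Hence a diagonal change of signs turns \<open>L\<close> into the unsigned operator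
  \<open>(U x)(I, J) = (\<Sum>k\<in>I - J. x(I - k, J + k))\<close> (\<open>twist_H'_L\<close>). For fixed \<open>I \<inter> J\<close> and \<open>I \<union> J\<close> this
  is the up operator of the Boolean lattice of subsets of the symmetric difference. The power
  \<open>U\<^sup>r\<close> is \<open>r!\<close> times a sum over the \<open>r\<close>-element subsets of \<open>I - J\<close>, and inclusion-exclusion over
  \<open>A \<subseteq> I - J\<close> recovers a coordinate from the powers of \<open>U\<close> (\<open>shift_op_inversion\<close>):
  with \<open>q = card (J - I)\<close> and \<open>card (I - J) \<le> q\<close>,

  \<open>x(I, J) = (\<Sum>A\<subseteq>I - J. (-1)\<^bsup>|A|\<^esup> / (q - |A|)! * (U\<^bsup>q - |A|\<^esup> x)(I \<union> J - A, I \<inter> J \<union> A))\<close>.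

  If \<open>d = |J| - |I| \<ge> 0\<close>, all exponents on the right are at least \<open>d\<close>, so \<open>U\<^sup>d x = 0\<close> forces
  \<open>x = 0\<close> in degree \<open>-d\<close>. This is the injectivity in hard Lefschetz, and transposition shows that the
  dimensions in degrees \<open>-d\<close> and \<open>d\<close> agree. The exponent \<open>d\<close> itself occurs only for \<open>A = I - J\<close>,
  where the coordinate on the right is \<open>(J, I)\<close>. So if \<open>L\<^bsup>d+1\<^esup> x = 0\<close>, then transposing \<open>L\<^sup>d x\<close>
  gives \<open>\<plusminus>d! x\<close> (\<open>primitive_reflection\<close>), and pairing it with \<open>x\<close> gives a sign times
  \<open>d!\<close> times the squared norm of \<open>x\<close>. Counting parities shows that this
  sign is \<open>(-1)\<^bsup>i - s\<^esup>\<close> (\<open>hodge_riemann_sign\<close>).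
\<close>

section \<open>Moving elements between two sets\<close>

lemma sum_Pow_alternating:
  assumes "finite S"
  shows "(\<Sum>A\<in>Pow S. (-1) ^ card A) = (if S = {} then 1 else 0 :: real)"
  using prod_diff_conv_sum[of S "\<lambda>_. 1" "\<lambda>_. 1 :: real"] assms by (simp add: power_0_left)

definition shift_op :: "'n::{finite,linorder} ext2 \<Rightarrow> 'n ext2" where
  "shift_op x = (\<chi> p. \<Sum>k\<in>fst p - snd p. x $ (fst p - {k}, insert k (snd p)))"

lemma shift_op_nth: "shift_op x $ (I, J) = (\<Sum>k\<in>I - J. x $ (I - {k}, insert k J))"
  by (simp add: shift_op_def)

text \<open>
  Applying the operator \<open>r\<close> times moves the elements of an \<open>r\<close>-element subset \<open>K\<close> of \<open>I - J\<close> one at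
  a time, and each \<open>K\<close> arises from its \<open>r!\<close> orderings.
\<close>

lemma shift_op_pow_nth:
  "(shift_op ^^ r) x $ (I, J) =
     fact r * (\<Sum>K | K \<subseteq> I - J \<and> card K = r. x $ (I - K, J \<union> K))"
proof (induction r arbitrary: I J)
  case 0
  have "{K. K \<subseteq> I - J \<and> card K = 0} = {{}}" by auto
  then show ?case by simp
next
  case (Suc r)
  let ?f = "\<lambda>K. x $ (I - K, J \<union> K)"
  have "(shift_op ^^ Suc r) x $ (I, J) = (\<Sum>k\<in>I - J. fact r *
      (\<Sum>K | K \<subseteq> I - {k} - insert k J \<and> card K = r. x $ (I - {k} - K, insert k J \<union> K)))"
    by (simp add: shift_op_nth Suc)
  also have "\<dots> = fact r * (\<Sum>k\<in>I - J.
      \<Sum>K | K \<subseteq> I - {k} - insert k J \<and> card K = r. x $ (I - {k} - K, insert k J \<union> K))"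
    by (simp add: sum_distrib_left)
  also have "(\<Sum>k\<in>I - J. \<Sum>K | K \<subseteq> I - {k} - insert k J \<and> card K = r.
        x $ (I - {k} - K, insert k J \<union> K)) =
      (\<Sum>(k, K)\<in>(SIGMA k:I - J. {K. K \<subseteq> I - {k} - insert k J \<and> card K = r}).
        ?f (insert k K))"
    by (subst sum.Sigma) (auto intro!: sum.cong arg_cong[where f="\<lambda>p. x $ p"])
  also have "\<dots> = (\<Sum>(K, k)\<in>(SIGMA K:{K. K \<subseteq> I - J \<and> card K = Suc r}. K). ?f K)"
    by (rule sum.reindex_bij_witness[of _ "\<lambda>(K, k). (k, K - {k})" "\<lambda>(k, K). (insert k K, k)"])
       (auto simp: card_insert_if insert_absorb)
  also have "\<dots> = (\<Sum>K | K \<subseteq> I - J \<and> card K = Suc r. \<Sum>k\<in>K. ?f K)"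
    by (subst sum.Sigma) auto
  also have "\<dots> = real (Suc r) * (\<Sum>K | K \<subseteq> I - J \<and> card K = Suc r. ?f K)"
    by (simp add: sum_distrib_left)
  finally show ?case by (simp add: algebra_simps)
qed

text \<open>
  Expanding the powers writes the right-hand side as a sum over pairs \<open>A \<subseteq> M\<close>, where \<open>M = A \<union> K\<close> is
  the set of all elements moved out of \<open>I \<union> J\<close> and has the fixed size \<open>card (J - I)\<close>. The
  alternating sum over \<open>A \<subseteq> M \<inter> (I - J)\<close> leaves only those \<open>M\<close> that avoid \<open>I - J\<close>, and by
  its size such an \<open>M\<close> is \<open>J - I\<close>.
\<close>

lemma shift_op_inversion:
  fixes x :: "'n::{finite,linorder} ext2"
  assumes le: "card (I - J) \<le> card (J - I)"
  shows "x $ (I, J) = (\<Sum>A\<in>Pow (I - J). (-1) ^ card A / fact (card (J - I) - card A) *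
     (shift_op ^^ (card (J - I) - card A)) x $ (I \<union> J - A, I \<inter> J \<union> A))"
proof -
  define D where "D = (I - J) \<union> (J - I)"
  let ?q = "card (J - I)"
  let ?f = "\<lambda>M. x $ (I \<union> J - M, I \<inter> J \<union> M)"
  let ?S = "{M. M \<subseteq> D \<and> card M = ?q}"
  have "(\<Sum>A\<in>Pow (I - J). (-1) ^ card A / fact (?q - card A) *
      (shift_op ^^ (?q - card A)) x $ (I \<union> J - A, I \<inter> J \<union> A)) =
      (\<Sum>A\<in>Pow (I - J). \<Sum>M | M \<in> ?S \<and> A \<subseteq> M. (-1) ^ card A * ?f M)"
  proof (rule sum.cong[OF refl])
    fix A assume "A \<in> Pow (I - J)"
    then have A: "A \<subseteq> I - J" by simp
    then have cA: "card A \<le> ?q" using le card_mono[of "I - J" A] by simp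
    have diff: "(I \<union> J - A) - (I \<inter> J \<union> A) = D - A" using A by (auto simp: D_def)
    have "(\<Sum>K | K \<subseteq> D - A \<and> card K = ?q - card A. x $ (I \<union> J - A - K, I \<inter> J \<union> A \<union> K)) =
        (\<Sum>M | M \<in> ?S \<and> A \<subseteq> M. ?f M)"
    proof (rule sum.reindex_bij_witness[of _ "\<lambda>M. M - A" "\<lambda>K. A \<union> K"])
      fix K assume K: "K \<in> {K. K \<subseteq> D - A \<and> card K = ?q - card A}"
      then have "A \<inter> K = {}" by auto
      then show "A \<union> K \<in> {M. M \<in> ?S \<and> A \<subseteq> M}" "A \<union> K - A = K"
        using K A cA by (auto simp: card_Un_disjoint D_def)
      show "?f (A \<union> K) = x $ (I \<union> J - A - K, I \<inter> J \<union> A \<union> K)"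
        by (rule arg_cong[where f="\<lambda>p. x $ p"]) auto
    qed (auto simp: card_Diff_subset)
    then show "(-1) ^ card A / fact (?q - card A) *
        (shift_op ^^ (?q - card A)) x $ (I \<union> J - A, I \<inter> J \<union> A) =
        (\<Sum>M | M \<in> ?S \<and> A \<subseteq> M. (-1) ^ card A * ?f M)"
      by (simp add: shift_op_pow_nth diff sum_distrib_left)
  qed
  also have "\<dots> = (\<Sum>M\<in>?S. \<Sum>A | A \<in> Pow (I - J) \<and> A \<subseteq> M. (-1) ^ card A * ?f M)"
    by (rule sum.swap_restrict) auto
  also have "\<dots> = (\<Sum>M\<in>?S. if M = J - I then ?f M else 0)"
  proof (rule sum.cong[OF refl])
    fix M assume M: "M \<in> ?S"
    have "(\<Sum>A | A \<in> Pow (I - J) \<and> A \<subseteq> M. (-1) ^ card A * ?f M) =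
        (\<Sum>A\<in>Pow ((I - J) \<inter> M). (-1) ^ card A) * ?f M"
      unfolding sum_distrib_right by (rule sum.cong) auto
    also have "(I - J) \<inter> M = {} \<longleftrightarrow> M = J - I"
    proof
      assume "(I - J) \<inter> M = {}"
      then have "M \<subseteq> J - I" using M by (auto simp: D_def)
      then show "M = J - I" using M by (intro card_subset_eq) auto
    qed auto
    then have "(\<Sum>A\<in>Pow ((I - J) \<inter> M). (-1) ^ card A) = (if M = J - I then 1 else 0 :: real)"
      by (simp add: sum_Pow_alternating del: Pow_Int_eq)
    finally show "(\<Sum>A | A \<in> Pow (I - J) \<and> A \<subseteq> M. (-1) ^ card A * ?f M) =
        (if M = J - I then ?f M else 0)" by simp
  qed
  also have "\<dots> = ?f (J - I)" by (simp add: D_def)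
  also have "\<dots> = x $ (I, J)" by (rule arg_cong[where f="\<lambda>p. x $ p"]) auto
  finally show ?thesis ..
qed

section \<open>The sign twist\<close>

definition below_sign :: "'n::{finite,linorder} set \<Rightarrow> 'n \<Rightarrow> real" where
  "below_sign D k = (-1) ^ card {l \<in> D. l < k}"

text \<open>
  Each element of \<open>I - J\<close> contributes the sign with which \<open>L\<close> moves it. These signs
  stay the same along a chain of moves, because the symmetric difference does, so
  the product is the total sign of moving all of \<open>I - J\<close>.
\<close>

definition twist_sign :: "'n::{finite,linorder} set \<Rightarrow> 'n set \<Rightarrow> real" where
  "twist_sign I J = (\<Prod>k\<in>I - J. below_sign ((I - J) \<union> (J - I)) k)"

text \<open>The exponents of the signs run through \<open>0, \<dots>, card D - 1\<close>.\<close>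

lemma prod_below_sign: "(\<Prod>k\<in>D. below_sign D k) = (-1) ^ (card D * (card D - 1) div 2)"
proof (induction D rule: finite_linorder_max_induct[OF finite])
  case 1 show ?case by simp
next
  case (2 b D)
  then have "b \<notin> D" by auto
  have "below_sign (insert b D) k = below_sign D k" if "k \<in> D" for k
  proof -
    have "{l \<in> insert b D. l < k} = {l \<in> D. l < k}" using 2(2) that by auto
    then show ?thesis by (simp only: below_sign_def)
  qed
  moreover have "{l \<in> insert b D. l < b} = D" using 2(2) by auto
  then have "below_sign (insert b D) b = (-1) ^ card D" by (simp only: below_sign_def)
  moreover have "Suc (card D) * card D div 2 = card D + card D * (card D - 1) div 2"
    by (cases "card D") (auto simp: algebra_simps)
  ultimately show ?case using 2 \<open>b \<notin> D\<close> by (simp add: power_add mult.commute)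
qed

lemma twist_sign_square [simp]: "twist_sign I J * twist_sign I J = 1"
  by (simp add: twist_sign_def below_sign_def flip: prod.distrib power_add)

lemma twist_sign_swap:
  fixes I J :: "'n::{finite,linorder} set"
  defines "N \<equiv> card (I - J) + card (J - I)"
  shows "twist_sign I J * twist_sign J I = (-1) ^ (N * (N - 1) div 2)"
proof -
  have "twist_sign I J * twist_sign J I =
      (\<Prod>k\<in>(I - J) \<union> (J - I). below_sign ((I - J) \<union> (J - I)) k)"
    unfolding twist_sign_def Un_commute[of "J - I"] by (rule prod.union_disjoint[symmetric]) auto
  also have "\<dots> = (-1) ^ (N * (N - 1) div 2)"
  proof -
    have "card ((I - J) \<union> (J - I)) = N"
      unfolding N_def by (rule card_Un_disjoint) auto
    then show ?thesis by (simp only: prod_below_sign)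
  qed
  finally show ?thesis .
qed

text \<open>
  The power of \<open>-1\<close> on the left is the sign in \<open>L\<close>, which counts the smaller elements of \<open>I\<close> and of \<open>J\<close>
  separately. Elements of \<open>I \<inter> J\<close> are counted twice, so only the symmetric difference
  matters for the parity.
\<close>

lemma twist_sign_shift:
  assumes "k \<in> I" "k \<notin> J"
  shows "twist_sign I J * (-1) ^ (card {l\<in>I. l < k} + card {l\<in>J. l < k}) =
    twist_sign (I - {k}) (insert k J)"
proof -
  let ?D = "(I - J) \<union> (J - I)"
  have D: "(I - {k} - insert k J) \<union> (insert k J - (I - {k})) = ?D" using assms by auto
  have "I - J = insert k (I - {k} - insert k J)" using assms by auto
  then have "twist_sign I J = below_sign ?D k * (\<Prod>k\<in>I - {k} - insert k J. below_sign ?D k)"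
    unfolding twist_sign_def by (metis (no_types) Diff_iff finite insertI1 prod.insert)
  then have 1: "twist_sign I J = below_sign ?D k * twist_sign (I - {k}) (insert k J)"
    by (simp only: twist_sign_def D)
  let ?b = "\<lambda>A. card {l\<in>A. l < k}"
  have "?b I = ?b (I - J) + ?b (I \<inter> J)" "?b J = ?b (J - I) + ?b (I \<inter> J)" "?b ?D = ?b (I - J) + ?b (J - I)"
    by (subst card_Un_disjoint[symmetric]; auto intro!: arg_cong[where f=card])+
  then have 2: "?b I + ?b J = ?b ?D + 2 * ?b (I \<inter> J)" by linarith
  show ?thesis unfolding 1 2 below_sign_def by (simp add: power_add power_mult mult_ac flip: power_mult_distrib)
qed

text \<open>
  The two cases in the definition of \<open>eps\<close> are one formula modulo 2: replacing \<open>m\<close> by \<open>2n - m\<close>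
  changes the parity of \<open>m(m - 1)/2\<close> by \<open>m - n\<close>.
\<close>

lemma minus_one_power_eps:
  fixes n m :: nat
  assumes "m \<le> 2 * n"
  shows "((-1) ^ eps n m :: real) = (-1) ^ (m * (m - 1) div 2 + (m - n))"
proof (cases "m \<le> n")
  case False
  then obtain s where s: "m = n + s" "s > 0" by (metis less_imp_add_positive not_le)
  with assms obtain t where t: "n = s + t" by (auto simp: le_iff_add)
  show ?thesis
  proof -
    have "m * (m - 1) div 2 = t * (t - 1) div 2 + s * (2 * t) + s * (2 * s - 1)"
    proof (cases t)
      case 0 with s t show ?thesis by (simp add: algebra_simps)
    next
      case (Suc t')
      have "m * (m - 1) = t * (t - 1) + 2 * (s * (2 * t) + s * (2 * s - 1))"
        using s t Suc by (cases s) (auto simp: algebra_simps)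
      then show ?thesis by simp
    qed
    moreover have "even (s * (2 * s - 1) + s)" by auto
    moreover have "eps n m = t * (t - 1) div 2" using s t by (simp add: eps_def)
    moreover have "m - n = s" using s by simp
    ultimately show ?thesis
      by (simp add: minus_one_power_iff)
  qed
qed (simp add: eps_def)

text \<open>
  Used with \<open>c = card (I \<inter> J)\<close> and \<open>N\<close> the size of the symmetric difference, so that
  \<open>m = card I + card J\<close>.
\<close>

lemma even_triangular_sum:
  fixes c N :: nat
  defines "m \<equiv> 2 * c + N"
  shows "even (m * (m - 1) div 2 + N * (N - 1) div 2 + c)"
proof -
  have "m * (m - 1) = N * (N - 1) + 2 * (2 * (c * N) + c * (2 * c - 1))"
    unfolding m_def by (cases N; cases c) (auto simp: algebra_simps)
  then have "m * (m - 1) div 2 = N * (N - 1) div 2 + (2 * (c * N) + c * (2 * c - 1))" by simp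
  moreover have "even (c * (2 * c - 1) + c)" by auto
  ultimately show ?thesis by presburger
qed

section \<open>The form and the operator in coordinates\<close>

definition swap :: "'n::{finite,linorder} ext2 \<Rightarrow> 'n ext2" where
  "swap x = (\<chi> p. x $ (snd p, fst p))"

lemma swap_nth [simp]: "swap x $ (I, J) = x $ (J, I)"
  by (simp add: swap_def)

lemma linear_swap: "linear swap"
  by (auto intro!: linearI simp: swap_def Finite_Cartesian_Product.vec_eq_iff)

lemma swap_swap [simp]: "swap (swap x) = x"
  by (simp add: swap_def Finite_Cartesian_Product.vec_eq_iff)

lemma sum_swap: "(\<Sum>p\<in>UNIV. f (snd p, fst p)) = (\<Sum>p\<in>UNIV. f (p :: 'a::finite \<times> 'a))"
  by (rule sum.reindex_bij_witness[of _ prod.swap prod.swap]) auto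

lemma inner_swap: "swap x \<bullet> y = x \<bullet> swap y"
  using sum_swap[of "\<lambda>p. x $ p * swap y $ p"]
  by (simp add: inner_vec_def swap_def)

lemma swap_tens: "swap (tens u v) = tens v u"
  by (simp add: swap_def tens_def mult.commute Finite_Cartesian_Product.vec_eq_iff)

lemma inner_tens: "tens u v \<bullet> tens u' v' = (u \<bullet> u') * (v \<bullet> v')"
proof -
  have "tens u v \<bullet> tens u' v' = (\<Sum>p\<in>UNIV \<times> UNIV. (u $ fst p * u' $ fst p) * (v $ snd p * v' $ snd p))"
    by (simp add: inner_vec_def tens_def mult_ac)
  then show ?thesis
    by (simp only: inner_vec_def sum_product sum.cartesian_product case_prod_unfold inner_real_def)
qed

lemma linear_eq_tens:
  assumes "linear f" "linear g" "\<And>u v. f (tens u v) = g (tens u v)"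
  shows "f = g"
proof (rule linear_eq_axis[OF assms(1,2)])
  fix p :: "'a set \<times> 'a set"
  show "f (axis p 1) = g (axis p 1)"
    using assms(3) by (cases p) (simp flip: tens_mono)
qed

lemma bilinear_eq_tens:
  fixes f g :: "'n::{finite,linorder} ext2 \<Rightarrow> 'm::{finite,linorder} ext2 \<Rightarrow> 'c::real_vector"
  assumes "bilinear f" "bilinear g"
    "\<And>u v u' v'. f (tens u v) (tens u' v') = g (tens u v) (tens u' v')"
  shows "f = g"
proof (rule bilinear_eq_axis[OF assms(1,2)])
  fix p :: "'n set \<times> 'n set" and q :: "'m set \<times> 'm set"
  show "f (axis p 1) (axis q 1) = g (axis p 1) (axis q 1)"
    using assms(3) by (cases p; cases q) (simp flip: tens_mono)
qed

lemma bilinear_inner_comp: "linear f \<Longrightarrow> linear g \<Longrightarrow> bilinear (\<lambda>x y. c * (f x \<bullet> g y))"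
  by (auto simp: bilinear_def linear_add linear_cmul inner_add_left inner_add_right algebra_simps intro!: linearI)

lemma H'_form_eq_inner:
  "H'_form m x (y :: 'n::{finite,linorder} ext2) = (-1) ^ eps CARD('n) m * (x \<bullet> swap y)"
proof -
  have "H'_form m = (\<lambda>x y :: 'n ext2. (-1) ^ eps CARD('n) m * (x \<bullet> swap y))"
    by (rule bilinear_eq_tens)
       (simp_all add: bilinear_H'_form bilinear_inner_comp[OF linear_ident linear_swap]
         H'_form_tens swap_tens inner_tens ext_pairing_eq_inner inner_commute)
  then show ?thesis by metis
qed

lemma H'_form_commute: "H'_form m x y = H'_form m y x"
  by (simp add: H'_form_eq_inner inner_commute[of x] inner_swap)

text \<open>
  The adjoint of \<open>e\<^bsub>\<theta>k\<^esub> \<otimes> i\<^bsub>\<theta>k\<^esub>\<close> for the standard inner product is \<open>i\<^bsub>\<theta>k\<^esub> \<otimes> e\<^bsub>\<theta>k\<^esub>\<close>, its conjugate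
  under transposition.
\<close>

lemma H'_form_L:
  fixes x y :: "'n::{finite,linorder} ext2"
  shows "H'_form m (H'_L x) y = H'_form m x (H'_L y)"
proof -
  have "(\<lambda>x y :: 'n ext2. H'_L x \<bullet> swap y) = (\<lambda>x y. x \<bullet> swap (H'_L y))"
  proof (rule bilinear_eq_tens)
    show "bilinear (\<lambda>x y :: 'n ext2. H'_L x \<bullet> swap y)"
      using bilinear_inner_comp[OF linear_H'_L linear_swap, of 1] by simp
    show "bilinear (\<lambda>x y :: 'n ext2. x \<bullet> swap (H'_L y))"
      using bilinear_inner_comp[OF linear_ident linear_compose[OF linear_H'_L linear_swap], of 1]
      by simp
    fix u v u' v' :: "'n ext"
    have "int_prod k v \<bullet> u' = v \<bullet> wedge (ext_gen k) u'" for k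
      by (metis inner_commute int_prod_adjoint)
    then show "H'_L (tens u v) \<bullet> swap (tens u' v') = tens u v \<bullet> swap (H'_L (tens u' v'))"
      by (simp add: H'_L_tens linear_sum[OF linear_swap] swap_tens inner_sum_left inner_sum_right
          inner_tens int_prod_adjoint)
  qed
  then show ?thesis unfolding H'_form_eq_inner by metis
qed

lemma H'_form_L_pow: "H'_form m ((H'_L ^^ r) x) y = H'_form m x ((H'_L ^^ r) y)"
proof (induction r arbitrary: y)
  case (Suc r)
  have "H'_form m ((H'_L ^^ Suc r) x) y = H'_form m ((H'_L ^^ r) x) (H'_L y)"
    by (simp add: H'_form_L)
  also have "\<dots> = H'_form m x ((H'_L ^^ Suc r) y)"
    by (simp only: Suc funpow_Suc_right o_apply)
  finally show ?case .
qed simp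

lemma linear_H'_L_pow: "linear (H'_L ^^ r)"
proof (induction r)
  case (Suc r)
  show ?case using linear_compose[OF Suc.IH linear_H'_L] by (simp add: o_def)
qed (simp add: linear_ident id_def)

lemma ext_mono_in_power: "ext_mono I \<in> ext_power (card I)"
  by (auto simp: ext_power_iff axis_def split: if_splits)

text \<open>
  The degree is \<open>-m + 2 card I\<close>; with \<open>m = card I + card J\<close> it becomes \<open>card I - card J\<close>, which
  makes the effect of transposition on the degree visible.
\<close>

lemma H'_iff:
  "x \<in> H' m d \<longleftrightarrow>
    (\<forall>I J. x $ (I, J) \<noteq> 0 \<longrightarrow> card I + card J = m \<and> int (card I) - int (card J) = d)"
proof
  assume "x \<in> H' m d"
  then show "\<forall>I J. x $ (I, J) \<noteq> 0 \<longrightarrow> card I + card J = m \<and> int (card I) - int (card J) = d"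
    unfolding H'_def
  proof (induction rule: span_induct_alt)
    case (step c y z)
    have "y $ (I, J) \<noteq> 0 \<longrightarrow> card I + card J = m \<and> int (card I) - int (card J) = d" for I J
      using step(1) by (auto simp: tens_def ext_power_iff)
    with step(2) show ?case
      by (metis add.right_neutral mult_eq_0_iff vector_add_component vector_scaleR_component real_scaleR_def)
  qed simp
next
  assume x: "\<forall>I J. x $ (I, J) \<noteq> 0 \<longrightarrow> card I + card J = m \<and> int (card I) - int (card J) = d"
  have "(\<Sum>p\<in>UNIV. x $ p *\<^sub>R axis p 1) \<in> H' m d"
    unfolding H'_def
  proof (rule span_sum)
    fix p :: "'a set \<times> 'a set"
    obtain I J where p: "p = (I, J)" by (cases p)
    show "x $ p *\<^sub>R axis p 1 \<in> span {tens u v | u v i.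
      i \<le> m \<and> d = - int m + 2 * int i \<and> u \<in> ext_power i \<and> v \<in> ext_power (m - i)}"
    proof (cases "x $ p = 0")
      case False
      then have "card I + card J = m" "int (card I) - int (card J) = d" using x p by auto
      then have "axis p 1 = tens (ext_mono I) (ext_mono J) \<and> card I \<le> m \<and>
          d = - int m + 2 * int (card I) \<and>
          ext_mono I \<in> ext_power (card I) \<and> ext_mono J \<in> ext_power (m - card I)"
        by (auto simp: p tens_mono ext_mono_in_power)
      then show ?thesis by (intro span_scale span_base) blast
    qed (simp add: span_zero)
  qed
  then show "x \<in> H' m d" by (simp add: lin_ext_ident[unfolded lin_ext_def])
qed

lemma subspace_H': "subspace (H' m d)"
  unfolding H'_def by (rule subspace_span)

lemma total_space_H'_iff:
  "x \<in> total_space (H' m) \<longleftrightarrow> (\<forall>I J. x $ (I, J) \<noteq> 0 \<longrightarrow> card I + card J = m)"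
proof
  assume "x \<in> total_space (H' m)"
  then show "\<forall>I J. x $ (I, J) \<noteq> 0 \<longrightarrow> card I + card J = m"
    unfolding total_space_def
  proof (induction rule: span_induct_alt)
    case (step c y z)
    have "y $ (I, J) \<noteq> 0 \<longrightarrow> card I + card J = m" for I J
      using step(1) by (auto simp: H'_iff)
    with step(2) show ?case
      by (metis add.right_neutral mult_eq_0_iff vector_add_component vector_scaleR_component real_scaleR_def)
  qed simp
next
  assume x: "\<forall>I J. x $ (I, J) \<noteq> 0 \<longrightarrow> card I + card J = m"
  have "(\<Sum>p\<in>UNIV. x $ p *\<^sub>R axis p 1) \<in> total_space (H' m)"
    unfolding total_space_def
  proof (rule span_sum)
    fix p :: "'a set \<times> 'a set"
    obtain I J where p: "p = (I, J)" by (cases p)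
    have "x $ p *\<^sub>R axis p 1 \<in> H' m (int (card I) - int (card J))"
      using x by (auto simp: H'_iff p axis_def)
    then show "x $ p *\<^sub>R axis p 1 \<in> span (\<Union>d. H' m d)" by (intro span_base) auto
  qed
  then show "x \<in> total_space (H' m)" by (simp add: lin_ext_ident[unfolded lin_ext_def])
qed

lemma swap_H': "x \<in> H' m d \<Longrightarrow> swap x \<in> H' m (- d)"
  by (fastforce simp: H'_iff)

text \<open>
  Adjointness turns a coordinate of a product into an inner product with a contracted
  monomial, and in the next lemma a coordinate of a contraction into one with a multiplied monomial.
\<close>

lemma wedge_gen_nth:
  "wedge (ext_gen k) u $ I = (if k \<in> I then (-1) ^ card {l\<in>I. l < k} * u $ (I - {k}) else 0)"
proof -
  have "wedge (ext_gen k) u $ I = wedge (ext_gen k) u \<bullet> ext_mono I"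
    by (simp add: inner_axis)
  also have "\<dots> = u \<bullet> int_prod k (ext_mono I)"
    by (rule int_prod_adjoint)
  also have "\<dots> = (if k \<in> I then (-1) ^ card {l\<in>I. l < k} * u $ (I - {k}) else 0)"
    by (simp add: int_prod_mono inner_axis)
  finally show ?thesis .
qed

lemma int_prod_nth:
  "int_prod k v $ J = (if k \<in> J then 0 else (-1) ^ card {l\<in>J. l < k} * v $ insert k J)"
proof -
  have "int_prod k v $ J = ext_mono J \<bullet> int_prod k v"
    by (simp add: inner_axis' inner_real_def)
  also have "\<dots> = wedge (ext_gen k) (ext_mono J) \<bullet> v"
    by (rule int_prod_adjoint[symmetric])
  also have "\<dots> = (if k \<in> J then 0 else (-1) ^ card {l\<in>J. l < k} * v $ insert k J)"
    by (simp del: wedge_mono_mono add: wedge_gen_mono inner_axis')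
  finally show ?thesis .
qed

lemma H'_L_nth:
  "H'_L x $ (I, J) = (\<Sum>k\<in>I - J.
     (-1) ^ (card {l\<in>I. l < k} + card {l\<in>J. l < k}) * x $ (I - {k}, insert k J))"
proof -
  have "(\<lambda>x. H'_L x $ (I, J)) = (\<lambda>x. \<Sum>k\<in>I - J.
     (-1) ^ (card {l\<in>I. l < k} + card {l\<in>J. l < k}) * x $ (I - {k}, insert k J))"
  proof (rule linear_eq_tens)
    show "linear (\<lambda>x. H'_L x $ (I, J))"
      by (auto intro!: linearI simp: linear_add[OF linear_H'_L] linear_cmul[OF linear_H'_L])
    fix u v :: "'a ext"
    have "H'_L (tens u v) $ (I, J) =
        (\<Sum>k\<in>UNIV. wedge (ext_gen k) u $ I * int_prod k v $ J)"
      by (simp only: H'_L_tens sum_component) (simp add: tens_def)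
    also have "\<dots> = (\<Sum>k\<in>I - J. wedge (ext_gen k) u $ I * int_prod k v $ J)"
      by (rule sum.mono_neutral_right) (auto simp: wedge_gen_nth int_prod_nth)
    also have "\<dots> = (\<Sum>k\<in>I - J. (-1) ^ (card {l\<in>I. l < k} + card {l\<in>J. l < k}) *
        tens u v $ (I - {k}, insert k J))"
      by (rule sum.cong) (auto simp: wedge_gen_nth int_prod_nth tens_def power_add)
    finally show "H'_L (tens u v) $ (I, J) = \<dots>" .
  qed (auto intro!: linearI simp: sum.distrib sum_distrib_left algebra_simps)
  then show ?thesis by meson
qed

lemma H'_L_H': "x \<in> H' m d \<Longrightarrow> H'_L x \<in> H' m (d + 2)"
proof -
  assume x: "x \<in> H' m d"
  show ?thesis
    unfolding H'_iff
  proof (intro allI impI)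
    fix I J
    assume "H'_L x $ (I, J) \<noteq> 0"
    then obtain k where k: "k \<in> I - J" "x $ (I - {k}, insert k J) \<noteq> 0"
      unfolding H'_L_nth by (metis (mono_tags, lifting) mult_eq_0_iff sum.neutral)
    moreover have "card (I - {k}) = card I - 1" "card I > 0" "card (insert k J) = Suc (card J)"
      using k(1) by (auto simp: card_gt_0_iff)
    ultimately show "card I + card J = m \<and> int (card I) - int (card J) = d + 2"
      using x unfolding H'_iff by fastforce
  qed
qed

lemma H'_L_pow_H': "x \<in> H' m d \<Longrightarrow> (H'_L ^^ r) x \<in> H' m (d + 2 * int r)"
proof (induction r)
  case (Suc r)
  then show ?case using H'_L_H'[of "(H'_L ^^ r) x" m "d + 2 * int r"] by (simp add: algebra_simps)
qed simp

section \<open>Invariance under the symmetric group\<close>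

text \<open>
  The inner product of two wedge monomials is the determinant of the inner products of their
  factors, and permuting the basis vectors does not change these.
\<close>

lemma inner_ext_perm:
  fixes u v :: "'n::{finite,linorder} ext"
  assumes "\<sigma> permutes UNIV"
  shows "ext_perm \<sigma> u \<bullet> ext_perm \<sigma> v = u \<bullet> v"
proof -
  have inj: "\<sigma> k = \<sigma> l \<longleftrightarrow> k = l" for k l
    using permutes_inj[OF assms] by (auto simp: inj_def)
  let ?vs = "\<lambda>\<tau> I. map (\<lambda>k. axis (\<tau> k) (1::real)) (sorted_list_of_set I)"
  have perm: "ext_perm \<sigma> (ext_mono I) = wedges (map ext_vec (?vs \<sigma> I))" for I :: "'n set"
    by (simp add: ext_perm_mono o_def)
  have mono: "ext_mono I = wedges (map ext_vec (?vs id I))" for I :: "'n set"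
    by (subst ext_mono_eq_wedges) (simp add: o_def)
  have "(\<lambda>u v. ext_perm \<sigma> u \<bullet> ext_perm \<sigma> v) = (\<lambda>u v. u \<bullet> v)"
  proof (rule bilinear_eq_axis)
    show "bilinear (\<lambda>u v. ext_perm \<sigma> u \<bullet> ext_perm \<sigma> v)" "bilinear (\<lambda>u v :: 'n ext. u \<bullet> v)"
      using bilinear_inner_comp[OF linear_ext_perm linear_ext_perm, of 1]
        bilinear_inner_comp[OF linear_ident linear_ident, of 1] by simp_all
    fix I J :: "'n set"
    have "Matrix.mat (card I) (card I) (\<lambda>(r, c). ?vs \<sigma> J ! r \<bullet> ?vs \<sigma> I ! c) =
        Matrix.mat (card I) (card I) (\<lambda>(r, c). ?vs id J ! r \<bullet> ?vs id I ! c)"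
      if "card I = card J"
      by (rule eq_matI) (use that in \<open>auto simp: inner_axis_axis inj\<close>)
    then show "ext_perm \<sigma> (ext_mono I) \<bullet> ext_perm \<sigma> (ext_mono J) = ext_mono I \<bullet> ext_mono J"
      unfolding perm
      unfolding mono[of I] mono[of J]
      unfolding ext_pairing_eq_inner[symmetric] ext_pairing_wedges by (auto simp del: nth_map)
  qed
  then show ?thesis by meson
qed

text \<open>
  Contraction inherits its equivariance from exterior multiplication, its adjoint, because
  the permutations act by orthogonal maps.
\<close>

lemma int_prod_ext_perm:
  assumes \<sigma>: "\<sigma> permutes UNIV"
  shows "int_prod (\<sigma> k) (ext_perm \<sigma> v) = ext_perm \<sigma> (int_prod k v)"
proof (rule vector_eq_ldot[THEN iffD1, rule_format])
  fix w
  define u where "u = ext_perm (inv_into UNIV \<sigma>) w"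
  have w: "w = ext_perm \<sigma> u"
    using permutes_inverses(1)[OF \<sigma>]
    by (simp add: u_def ext_perm_ident flip: ext_perm_compose)
  show "w \<bullet> int_prod (\<sigma> k) (ext_perm \<sigma> v) = w \<bullet> ext_perm \<sigma> (int_prod k v)"
    unfolding w int_prod_adjoint[symmetric] ext_perm_gen_wedge[symmetric] inner_ext_perm[OF \<sigma>]
    by (rule refl)
qed

lemma H'_L_perm:
  assumes \<sigma>: "\<sigma> permutes UNIV"
  shows "H'_L (H'_perm \<sigma> x) = H'_perm \<sigma> (H'_L x)"
proof -
  have "(\<lambda>x. H'_L (H'_perm \<sigma> x)) = (\<lambda>x. H'_perm \<sigma> (H'_L x))"
  proof (rule linear_eq_tens)
    show "linear (\<lambda>x. H'_L (H'_perm \<sigma> x))" "linear (\<lambda>x. H'_perm \<sigma> (H'_L x))"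
      using linear_compose[OF linear_H'_perm linear_H'_L] linear_compose[OF linear_H'_L linear_H'_perm]
      by (simp_all add: o_def)
    fix u v :: "'a ext"
    have "H'_L (H'_perm \<sigma> (tens u v)) =
        (\<Sum>k\<in>UNIV. tens (wedge (ext_gen k) (ext_perm \<sigma> u)) (int_prod k (ext_perm \<sigma> v)))"
      by (simp add: H'_perm_tens H'_L_tens)
    also have "\<dots> = (\<Sum>k\<in>UNIV. tens (wedge (ext_gen (\<sigma> k)) (ext_perm \<sigma> u)) (int_prod (\<sigma> k) (ext_perm \<sigma> v)))"
      by (rule sum.reindex_bij_betw[symmetric]) (rule permutes_imp_bij[OF \<sigma>])
    also have "\<dots> = H'_perm \<sigma> (H'_L (tens u v))"
      by (simp add: H'_L_tens linear_sum[OF linear_H'_perm] H'_perm_tens ext_perm_gen_wedge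
          int_prod_ext_perm[OF \<sigma>])
    finally show "H'_L (H'_perm \<sigma> (tens u v)) = H'_perm \<sigma> (H'_L (tens u v))" .
  qed
  then show ?thesis by meson
qed

lemma H'_L_pow_perm:
  "\<sigma> permutes UNIV \<Longrightarrow> (H'_L ^^ r) (H'_perm \<sigma> x) = H'_perm \<sigma> ((H'_L ^^ r) x)"
  by (induction r) (simp_all add: H'_L_perm)

lemma H'_form_perm:
  assumes \<sigma>: "\<sigma> permutes UNIV"
  shows "H'_form m (H'_perm \<sigma> x) (H'_perm \<sigma> y) = H'_form m x y"
proof -
  have "(\<lambda>x y. H'_form m (H'_perm \<sigma> x) (H'_perm \<sigma> y)) = H'_form m"
  proof (rule bilinear_eq_tens[OF _ bilinear_H'_form])
    show "bilinear (\<lambda>x y. H'_form m (H'_perm \<sigma> x) (H'_perm \<sigma> y))"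
      unfolding bilinear_def
      by (auto intro!: linearI simp: linear_add[OF linear_H'_perm] linear_cmul[OF linear_H'_perm]
          bilinear_ladd[OF bilinear_H'_form] bilinear_radd[OF bilinear_H'_form]
          bilinear_lmul[OF bilinear_H'_form] bilinear_rmul[OF bilinear_H'_form])
  qed (simp add: H'_perm_tens H'_form_tens ext_pairing_eq_inner inner_ext_perm[OF \<sigma>])
  then show ?thesis by metis
qed

section \<open>Hard Lefschetz and the Hodge--Riemann sign\<close>

definition twist :: "'n::{finite,linorder} ext2 \<Rightarrow> 'n ext2" where
  "twist x = (\<chi> p. twist_sign (fst p) (snd p) * x $ p)"

lemma twist_nth: "twist x $ (I, J) = twist_sign I J * x $ (I, J)"
  by (simp add: twist_def)

lemma twist_0 [simp]: "twist 0 = 0"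
  by (simp add: twist_def Finite_Cartesian_Product.vec_eq_iff)

lemma twist_sign_twist_nth: "twist_sign I J * twist x $ (I, J) = x $ (I, J)"
  by (simp add: twist_nth flip: mult.assoc)

text \<open>The twist is an involution that conjugates \<open>L\<close> to the unsigned operator.\<close>

lemma twist_H'_L: "twist (H'_L x) = shift_op (twist x)"
proof (rule Finite_Cartesian_Product.vec_eq_iff[THEN iffD2, rule_format])
  fix p :: "'a set \<times> 'a set"
  obtain I J where p: "p = (I, J)" by (cases p)
  have "twist_sign I J * ((-1) ^ (card {l\<in>I. l < k} + card {l\<in>J. l < k}) * x $ (I - {k}, insert k J)) =
      twist x $ (I - {k}, insert k J)" if "k \<in> I - J" for k
    using twist_sign_shift[of k I J] that by (simp add: twist_nth flip: mult.assoc)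
  then show "twist (H'_L x) $ p = shift_op (twist x) $ p"
    by (simp add: p twist_nth[of "H'_L x"] H'_L_nth shift_op_nth sum_distrib_left)
qed

lemma twist_H'_L_pow: "twist ((H'_L ^^ r) x) = (shift_op ^^ r) (twist x)"
  by (induction r) (simp_all add: twist_H'_L)

lemma H'_L_pow_mono_eq_0:
  assumes "(H'_L ^^ r) x = 0" "r \<le> s"
  shows "(H'_L ^^ s) x = 0"
proof -
  have "(H'_L ^^ (s - r + r)) x = (H'_L ^^ (s - r)) ((H'_L ^^ r) x)"
    by (simp only: funpow_add o_apply)
  then show ?thesis using assms by (simp add: linear_0[OF linear_H'_L_pow])
qed

lemma card_Diff_add:
  fixes I J :: "'n::finite set"
  assumes "card J = card I + d"
  shows "card (J - I) = card (I - J) + d"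
  using assms card_Int_Diff[of I J] card_Int_Diff[of J I] by (simp add: Int_commute)

text \<open>
  Every power of the operator that occurs in the inversion formula is at least the \<open>d\<close>-th,
  hence kills \<open>x\<close>.
\<close>

lemma H'_L_pow_eq_0:
  assumes x: "x \<in> H' m (- int d)" and 0: "(H'_L ^^ d) x = 0"
  shows "x = 0"
proof (rule ccontr)
  assume "x \<noteq> 0"
  then obtain p where "x $ p \<noteq> 0" by (auto simp: Finite_Cartesian_Product.vec_eq_iff)
  then obtain I J where IJ: "x $ (I, J) \<noteq> 0" by (cases p) auto
  then have "card J = card I + d" using x unfolding H'_iff by fastforce
  note card = card_Diff_add[OF this]
  have "(shift_op ^^ r) (twist x) = 0" if "d \<le> r" for r
    unfolding twist_H'_L_pow[symmetric] H'_L_pow_mono_eq_0[OF 0 that] by simp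
  moreover have "d \<le> card (J - I) - card A" if "A \<in> Pow (I - J)" for A
    using card_mono[of "I - J" A] that card by simp
  ultimately have "twist x $ (I, J) = 0"
    by (subst shift_op_inversion) (auto simp: card intro!: sum.neutral)
  then show False using IJ twist_sign_twist_nth[of I J x] by simp
qed

text \<open>
  In the inversion formula only the term \<open>A = I - J\<close> has an exponent as small as \<open>d\<close>; the other
  terms vanish on primitive elements. That term is the coordinate at the transposed index.
\<close>

lemma primitive_reflection:
  assumes prim: "(H'_L ^^ Suc d) x = 0" and IJ: "card J = card I + d"
  shows "(H'_L ^^ d) x $ (J, I) =
    (-1) ^ card (I - J) * twist_sign I J * twist_sign J I * fact d * x $ (I, J)"
proof -
  note card = card_Diff_add[OF IJ]
  let ?g = "\<lambda>A. (-1) ^ card A / fact (card (J - I) - card A) *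
     (shift_op ^^ (card (J - I) - card A)) (twist x) $ (I \<union> J - A, I \<inter> J \<union> A)"
  have "?g A = 0" if "A \<in> Pow (I - J) - {I - J}" for A
  proof -
    have "card A < card (I - J)" using that by (intro psubset_card_mono) auto
    then have "(H'_L ^^ (card (J - I) - card A)) x = 0"
      using card by (intro H'_L_pow_mono_eq_0[OF prim]) simp
    then show ?thesis by (simp flip: twist_H'_L_pow)
  qed
  then have "(\<Sum>A\<in>Pow (I - J). ?g A) = (\<Sum>A\<in>{I - J}. ?g A)"
    by (intro sum.mono_neutral_right) auto
  moreover have "twist x $ (I, J) = (\<Sum>A\<in>Pow (I - J). ?g A)"
    using card by (intro shift_op_inversion) simp
  moreover have "I \<union> J - (I - J) = J" "I \<inter> J \<union> (I - J) = I" by auto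
  ultimately have "twist x $ (I, J) = (-1) ^ card (I - J) / fact d * twist ((H'_L ^^ d) x) $ (J, I)"
    by (simp add: card twist_H'_L_pow)
  then have "(-1) ^ card (I - J) * fact d * twist x $ (I, J) = twist ((H'_L ^^ d) x) $ (J, I)"
    by (simp flip: mult.assoc power_add)
  then have "(H'_L ^^ d) x $ (J, I) = twist_sign J I * ((-1) ^ card (I - J) * fact d * twist x $ (I, J))"
    by (simp only: twist_sign_twist_nth)
  then show ?thesis by (simp add: twist_nth mult_ac)
qed

lemma minus_one_powi_diff: "(-1 :: real) powi (int i - int s) = (-1) ^ (i + s)"
  by (simp add: power_int_diff power_int_of_nat power_add minus_one_power_iff)

text \<open>
  Write \<open>c = card (I \<inter> J)\<close> and let \<open>N\<close> be the size of the symmetric difference. The two twist signs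
  multiply to \<open>(-1)\<close> to the power \<open>N(N - 1)/2\<close>, which with \<open>m = 2c + N\<close> is \<open>m(m - 1)/2 + c\<close> modulo 2.
  The remaining exponents \<open>c\<close> and \<open>card (I - J)\<close> add up to \<open>card I\<close>, and
  \<open>minus_one_power_eps\<close> accounts for the maximum.
\<close>

lemma hodge_riemann_sign:
  fixes I J :: "'n::{finite,linorder} set"
  assumes m: "card I + card J = m"
  shows "(-1) powi (int (card I) - max 0 (int m - int CARD('n))) *
    ((-1) ^ eps CARD('n) m * ((-1) ^ card (I - J) * twist_sign I J * twist_sign J I)) = 1"
proof -
  let ?c = "card (I \<inter> J)" and ?s = "m - CARD('n)"
  define N where "N = card (I - J) + card (J - I)"
  have cI: "card I = ?c + card (I - J)" and cJ: "card J = ?c + card (J - I)"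
    using card_Int_Diff[of I J] card_Int_Diff[of J I] by (simp_all add: Int_commute)
  have "card I \<le> CARD('n)" "card J \<le> CARD('n)" by (simp_all add: card_mono)
  then have e: "((-1) ^ eps CARD('n) m :: real) = (-1) ^ (m * (m - 1) div 2 + ?s)"
    using m by (intro minus_one_power_eps) simp
  have "max 0 (int m - int CARD('n)) = int ?s" by simp
  then have p: "(-1 :: real) powi (int (card I) - max 0 (int m - int CARD('n))) = (-1) ^ (card I + ?s)"
    by (simp only: minus_one_powi_diff)
  have t: "twist_sign I J * twist_sign J I = (-1) ^ (N * (N - 1) div 2)"
    unfolding N_def by (rule twist_sign_swap)
  have "m = 2 * ?c + N" using m cI cJ by (simp add: N_def)
  then have "even (m * (m - 1) div 2 + N * (N - 1) div 2 + ?c)"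
    using even_triangular_sum[of ?c N] by simp
  then have "even (card I + ?s + (m * (m - 1) div 2 + ?s + (card (I - J) + N * (N - 1) div 2)))"
    unfolding cI by presburger
  then show ?thesis
    unfolding e p mult.assoc t by (simp flip: power_add)
qed

text \<open>
  On primitive elements the Lefschetz form is, up to the predicted sign, a positive multiple of
  the standard inner product.
\<close>

lemma lefschetz_form_primitive:
  fixes a :: "'n::{finite,linorder} ext2"
  assumes a: "a \<in> primitive_subspace m i" and i: "2 * i \<le> m"
  shows "(-1) powi (int i - max 0 (int m - int CARD('n))) * lefschetz_form m i a a =
    fact (m - 2 * i) * (a \<bullet> a)"
proof -
  let ?d = "m - 2 * i"
  let ?\<sigma> = "(-1) powi (int i - max 0 (int m - int CARD('n))) * (-1) ^ eps CARD('n) m :: real"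
  have mem: "a \<in> H' m (- int m + 2 * int i)" and prim: "(H'_L ^^ Suc ?d) a = 0"
    using a by (auto simp: primitive_subspace_def)
  have "a $ p * (?\<sigma> * swap ((H'_L ^^ ?d) a) $ p) = a $ p * (fact ?d * a $ p)" for p
  proof (cases "a $ p = 0")
    case False
    obtain I J where p: "p = (I, J)" by (cases p)
    from False have IJ: "card I + card J = m" "card I = i"
      using mem unfolding p H'_iff by force+
    then have "card J = card I + ?d" using i by simp
    from primitive_reflection[OF prim this] hodge_riemann_sign[OF IJ(1)]
    show ?thesis by (simp add: p IJ(2) mult_ac)
  qed simp
  then have "a \<bullet> (?\<sigma> *\<^sub>R swap ((H'_L ^^ ?d) a)) = a \<bullet> (fact ?d *\<^sub>R a)"
    by (simp only: inner_vec_def inner_real_def vector_scaleR_component real_scaleR_def)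
  then show ?thesis
    by (simp add: lefschetz_form_def H'_form_eq_inner mult.assoc)
qed

text \<open>
  Followed by transposition, \<open>L\<^sup>d\<close> becomes an injective endomorphism of the finite-dimensional space
  in degree \<open>-d\<close>, hence is onto.
\<close>

lemma H'_L_pow_iso: "linear_iso_betw (H'_L ^^ d) (H' m (- int d)) (H' m (int d))"
proof -
  let ?S = "H' m (- int d) :: 'a ext2 set"
  let ?f = "\<lambda>x. swap ((H'_L ^^ d) x)"
  have lin: "linear ?f"
    using linear_compose[OF linear_H'_L_pow linear_swap] by (simp add: o_def)
  have inj: "inj_on (H'_L ^^ d) ?S"
  proof (rule inj_onI)
    fix x y assume "x \<in> ?S" "y \<in> ?S" "(H'_L ^^ d) x = (H'_L ^^ d) y"
    then show "x = y"
      using H'_L_pow_eq_0[of "x - y" m d]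
      by (simp add: subspace_diff[OF subspace_H'] linear_diff[OF linear_H'_L_pow])
  qed
  have into: "(H'_L ^^ d) x \<in> H' m (int d)" if "x \<in> ?S" for x
    using H'_L_pow_H'[OF that, of d] by simp
  have "inj_on ?f (span ?S)"
    unfolding span_eq_iff[THEN iffD2, OF subspace_H']
    using inj by (metis (no_types, lifting) inj_on_def swap_swap)
  then have "dim (?f ` ?S) = dim ?S" by (rule dim_image_eq[OF lin])
  moreover have "?f ` ?S \<subseteq> ?S" using swap_H'[OF into] by auto
  ultimately have im: "?f ` ?S = ?S"
    by (intro subspace_dim_equal linear_subspace_image[OF lin] subspace_H') simp_all
  have "y \<in> (H'_L ^^ d) ` ?S" if "y \<in> H' m (int d)" for y
  proof -
    have "swap y \<in> ?f ` ?S" unfolding im using swap_H'[OF that] by simp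
    then show ?thesis by (metis (no_types, lifting) image_iff swap_swap)
  qed
  with into have "(H'_L ^^ d) ` ?S = H' m (int d)" by auto
  with inj show ?thesis
    by (auto simp: linear_iso_betw_def bij_betw_def linear_map_on_def
        linear_add[OF linear_H'_L_pow] linear_cmul[OF linear_H'_L_pow])
qed

lemma symmetric_bilinear_form_onI:
  assumes "bilinear B" "\<And>a b. B a b = B b a"
  shows "symmetric_bilinear_form_on S B"
  using assms(2) unfolding symmetric_bilinear_form_on_def bilinear_form_on_def linear_map_on_def
  by (auto simp: bilinear_ladd[OF assms(1)] bilinear_radd[OF assms(1)]
      bilinear_lmul[OF assms(1)] bilinear_rmul[OF assms(1)])

lemma bilinear_lefschetz_form: "bilinear (lefschetz_form m i)"
  unfolding bilinear_def lefschetz_form_def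
  by (auto intro!: linearI simp: linear_add[OF linear_H'_L_pow] linear_cmul[OF linear_H'_L_pow]
      bilinear_ladd[OF bilinear_H'_form] bilinear_radd[OF bilinear_H'_form]
      bilinear_lmul[OF bilinear_H'_form] bilinear_rmul[OF bilinear_H'_form])

lemma lefschetz_form_commute: "lefschetz_form m i a b = lefschetz_form m i b a"
  unfolding lefschetz_form_def by (metis H'_form_L_pow H'_form_commute)

lemma graded_form_H': "graded_form (H' m) (H'_form m)"
  unfolding graded_form_def
proof (intro allI impI ballI)
  fix i j :: int and a b :: "'a ext2"
  assume ij: "i \<noteq> - j" and a: "a \<in> H' m i" and b: "b \<in> H' m j"
  have "a $ p * swap b $ p = 0" for p
  proof (rule ccontr)
    obtain I J where p: "p = (I, J)" by (cases p)
    assume "a $ p * swap b $ p \<noteq> 0"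
    then have "int (card I) - int (card J) = i" "int (card J) - int (card I) = j"
      using a b unfolding p H'_iff by auto
    with ij show False by simp
  qed
  then have "a \<bullet> swap b = 0" by (simp only: inner_vec_def inner_real_def sum.neutral_const)
  then show "H'_form m a b = 0" by (simp add: H'_form_eq_inner)
qed

lemma nondegenerate_H'_form: "nondegenerate_on (total_space (H' m)) (H'_form m)"
proof -
  have "a = 0" if a: "a \<in> total_space (H' m)" and 0: "\<forall>b\<in>total_space (H' m). H'_form m a b = 0"
    for a :: "'a ext2"
  proof -
    have "swap a \<in> total_space (H' m)" using a by (fastforce simp: total_space_H'_iff)
    with 0 show ?thesis by (fastforce simp: H'_form_eq_inner)
  qed
  then show ?thesis unfolding nondegenerate_on_def by (auto simp: H'_form_commute)
qed

theorem theorem12: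
  fixes m :: nat
    and H :: "int \<Rightarrow> 'n::{finite,linorder} ext2 set"
  assumes "m \<le> 2 * CARD('n)"
    and H: "H = H' m"
  shows
    "(symmetric_bilinear_form_on (total_space H) (H'_form m) \<and>
      graded_form H (H'_form m) \<and>
      equivariant_form_on (total_space H) (H'_form m) \<and>
      nondegenerate_on (total_space H) (H'_form m)) \<and>
     (lefschetz_operator H (H'_form m) H'_L \<and>
      equivariant_map_on (total_space H) H'_L \<and>
      hard_lefschetz H H'_L) \<and>
     (\<forall>i::nat. 2 * i \<le> m \<longrightarrow>
        symmetric_bilinear_form_on (H (- int m + 2 * int i)) (lefschetz_form m i) \<and>
        equivariant_form_on (H (- int m + 2 * int i)) (lefschetz_form m i) \<and>
        sign_definite_on (int i - max 0 (int m - int CARD('n)))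
          (primitive_subspace m i :: 'n ext2 set) (lefschetz_form m i))"
proof (intro conjI allI impI)
  show "symmetric_bilinear_form_on (total_space H) (H'_form m)"
    by (intro symmetric_bilinear_form_onI bilinear_H'_form H'_form_commute)
  show "graded_form H (H'_form m)" unfolding H by (rule graded_form_H')
  show "equivariant_form_on (total_space H) (H'_form m)"
    by (simp add: equivariant_form_on_def H'_form_perm)
  show "nondegenerate_on (total_space H) (H'_form m)"
    unfolding H by (rule nondegenerate_H'_form)
  show "lefschetz_operator H (H'_form m) H'_L"
    by (auto simp: lefschetz_operator_def degree_two_map_def linear_map_on_def H H'_L_H' H'_form_L
        linear_add[OF linear_H'_L] linear_cmul[OF linear_H'_L])
  show "equivariant_map_on (total_space H) H'_L"
    by (simp add: equivariant_map_on_def H'_L_perm)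
  show "hard_lefschetz H H'_L"
    unfolding hard_lefschetz_def H by (intro allI H'_L_pow_iso)
  fix i :: nat assume i: "2 * i \<le> m"
  show "symmetric_bilinear_form_on (H (- int m + 2 * int i)) (lefschetz_form m i)"
    by (intro symmetric_bilinear_form_onI bilinear_lefschetz_form lefschetz_form_commute)
  show "equivariant_form_on (H (- int m + 2 * int i)) (lefschetz_form m i)"
    by (simp add: equivariant_form_on_def lefschetz_form_def H'_L_pow_perm H'_form_perm)
  have "(-1) powi (int i - max 0 (int m - int CARD('n))) * lefschetz_form m i a a > 0"
    if "a \<in> primitive_subspace m i" "a \<noteq> 0" for a :: "'n ext2"
    unfolding lefschetz_form_primitive[OF that(1) i] using that(2) by simp
  then show "sign_definite_on (int i - max 0 (int m - int CARD('n)))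
      (primitive_subspace m i :: 'n ext2 set) (lefschetz_form m i)"
    by (auto simp: sign_definite_on_def intro: symmetric_bilinear_form_onI bilinear_lefschetz_form
        lefschetz_form_commute)
qed

end
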